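(* Suppose that $k_1,k_2:S\to\mathrm{SU}(2)$ are measurable multiloops of the form $$k_1=\begin{pmatrix}a(z)&b(z)\\-b^*(z)&a^*(z)\end{pmatrix}\qquad\text{and}\qquad k_2=\begin{pmatrix}d^*(z)&-c^*(z)\\c(z)&d(z)\end{pmatrix},$$ where $a$, $b$, $c$ and $d$ are boundary values of holomorphic functions in $\Sigma$. Then $$A(k_1^*k_2)=A(k_1^* )A(k_2).$$
   Context: $\Sigma$ is a connected compact Riemann surface with nonempty boundary $S$ (a disjoint union of circles); $\Sigma^*$ is $\Sigma$ with reversed orientation; $\widehat\Sigma=\Sigma^*\circ\Sigma$ is the double, obtained by sewing along $S$; $R$ is the antiholomorphic involution of $\widehat\Sigma$ fixing $S$ pointwise. For functions on $S$, $f^*$ is the pointwise complex conjugate (Hermitian adjoint for matrices); if $f$ is holomorphic in $\Sigma$, $f^*(q)=f(R(q))^*$ is holomorphic in $\Sigma^*$. A spin structure on $\Sigma$ is a holomorphic square root $\kappa^{1/2}$ of the canonical bundle $\kappa$. It induces a spin structure $\kappa^{1/2}$ on $\widehat\Sigma$ with an antiholomorphic reflection symmetry compatible with $R$ (double $\kappa^{1/2}$ along $S$ using the real structure on $\kappa^{1/2}|_S$ whose real elements $s$ are those with $s\otimes s$ a nonnegative real one-form on the oriented manifold $S$). Assume that $\overline\partial$ on sections of $\kappa^{1/2}\to\widehat\Sigma$ is invertible. On $\mathbb C^2$-valued $L^2$ sections of $\kappa^{1/2}|_S$, denoted $\Omega^{1/2}(S)\otimes\mathbb C^2$, the inner product is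 $\langle\psi,\phi\rangle=\int_S(\psi,\overline\phi)_{\mathbb C^2}$, where $(v,\overline w)_{\mathbb C^2}$ is the standard Hermitian inner product on $\mathbb C^2$ (so the integrand is a one-density). There is a Hilbert space polarization $\Omega^{1/2}(S)\otimes\mathbb C^2=H_+\oplus H_-$, where $H_+$ and $H_-$ are the $L^2$-closures of the boundary values of $\mathbb C^2$-valued holomorphic sections of $\kappa^{1/2}$ over $\Sigma$ and $\Sigma^*$ respectively. For a bounded measurable $2\times2$ matrix function $g$ on $S$, $A(g)$ is the compression to $H_+$ of the multiplication operator $M_g$ on $\Omega^{1/2}(S)\otimes\mathbb C^2$, i.e. the $H_+\to H_+$ block of $M_g$ relative to this polarization.
   Formalization: "Boundary values of holomorphic functions" is taken as a.e. nontangential limits of holomorphic functions bounded near S; without boundedness the claim fails on the disc (a = 1/θ, d = θ with θ singular inner, b = c = 0). *)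

theory Defs
  imports "HOL-Complex_Analysis.Complex_Analysis"
begin

section \<open>Surfaces given by an atlas\<close>

text \<open>A point set with a topology and an atlas of charts \<open>chart i\<close> defined on \<open>cdom i\<close>.
  Values of charts outside their domains are irrelevant.\<close>

record ('a, 'i) surface =
  surf_top :: "'a topology"
  idx :: "'i set"
  cdom :: "'i \<Rightarrow> 'a set"
  chart :: "'i \<Rightarrow> 'a \<Rightarrow> complex"

definition inv_chart :: "('a, 'i) surface \<Rightarrow> 'i \<Rightarrow> complex \<Rightarrow> 'a" where
  "inv_chart Y i = the_inv_into (cdom Y i) (chart Y i)"

definition overlap :: "('a, 'i) surface \<Rightarrow> 'i \<Rightarrow> 'i \<Rightarrow> complex set" where
  "overlap Y i j = chart Y j ` (cdom Y i \<inter> cdom Y j)"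

definition transition :: "('a, 'i) surface \<Rightarrow> 'i \<Rightarrow> 'i \<Rightarrow> complex \<Rightarrow> complex" where
  "transition Y i j = chart Y i \<circ> inv_chart Y j"

text \<open>Holomorphy on a set that need not be open in the plane (a relatively open subset of the
  closed half plane): extendability to a holomorphic function on a neighbourhood.\<close>

definition holomorphic_up_to :: "(complex \<Rightarrow> complex) \<Rightarrow> complex set \<Rightarrow> bool" where
  "holomorphic_up_to f V \<longleftrightarrow> (\<exists>F. F analytic_on V \<and> (\<forall>z\<in>V. F z = f z))"

text \<open>All charts, interior ones included, take values in the closed upper half plane; the boundary
  is where a chart is real.  This normalisation makes the doubling below uniform in the charts.\<close>

definition half_plane :: "complex set" where
  "half_plane = {z. 0 \<le> Im z}"

definition bd :: "('a, 'i) surface \<Rightarrow> 'a set" where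
  "bd Y = {p. \<exists>i\<in>idx Y. p \<in> cdom Y i \<and> Im (chart Y i p) = 0}"

definition compact_connected_bordered_riemann_surface :: "('a, 'i) surface \<Rightarrow> bool" where
  "compact_connected_bordered_riemann_surface Y \<longleftrightarrow>
     Hausdorff_space (surf_top Y) \<and> compact_space (surf_top Y) \<and> connected_space (surf_top Y) \<and>
     (\<Union>i\<in>idx Y. cdom Y i) = topspace (surf_top Y) \<and>
     (\<forall>i\<in>idx Y. openin (surf_top Y) (cdom Y i) \<and>
        openin (top_of_set half_plane) (chart Y i ` cdom Y i) \<and>
        homeomorphic_map (subtopology (surf_top Y) (cdom Y i))
          (top_of_set (chart Y i ` cdom Y i)) (chart Y i)) \<and>
     (\<forall>i\<in>idx Y. \<forall>j\<in>idx Y. holomorphic_up_to (transition Y i j) (overlap Y i j))"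

section \<open>Spin structures\<close>

text \<open>A holomorphic square root of the canonical bundle, presented by its cocycle.  Trivialise
  \<open>\<kappa>\<^sup>1\<^sup>/\<^sup>2\<close> over \<open>cdom i\<close> by a square root \<open>e i\<close> of \<open>d(chart i)\<close> and let \<open>e i = s i j * e j\<close>; then
  \<open>(s i j)\<^sup>2 = d(chart i) / d(chart j)\<close>, the cocycle of \<open>\<kappa>\<close>.  Such \<open>e i\<close> exist as soon as the chart
  domains are simply connected, so every square root arises over a suitable atlas.  A section
  is a family \<open>f\<close> of coefficients with \<open>f i * e i = f j * e j\<close>.\<close>

definition spin_structure :: "('a, 'i) surface \<Rightarrow> ('i \<Rightarrow> 'i \<Rightarrow> 'a \<Rightarrow> complex) \<Rightarrow> bool" where
  "spin_structure Y s \<longleftrightarrow>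
     (\<forall>i\<in>idx Y. \<forall>j\<in>idx Y.
        holomorphic_up_to (s i j \<circ> inv_chart Y j) (overlap Y i j) \<and>
        (\<forall>p \<in> cdom Y i \<inter> cdom Y j.
           (transition Y i j has_field_derivative (s i j p)\<^sup>2)
             (at (chart Y j p) within overlap Y i j))) \<and>
     (\<forall>i\<in>idx Y. \<forall>j\<in>idx Y. \<forall>k\<in>idx Y. \<forall>p \<in> cdom Y i \<inter> cdom Y j \<inter> cdom Y k.
        s i j p * s j k p = s i k p)"

definition section_over ::
  "('a, 'i) surface \<Rightarrow> ('i \<Rightarrow> 'i \<Rightarrow> 'a \<Rightarrow> complex) \<Rightarrow> 'a set \<Rightarrow> ('i \<Rightarrow> 'a \<Rightarrow> complex) \<Rightarrow> bool" where
  "section_over Y s W f \<longleftrightarrow>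
     (\<forall>i\<in>idx Y. \<forall>j\<in>idx Y. \<forall>p \<in> cdom Y i \<inter> cdom Y j \<inter> W. f j p = f i p * s i j p)"

section \<open>The double\<close>

text \<open>Two copies of the surface, sewn along the boundary.  The copy with flag \<open>False\<close> carries the
  reversed orientation; boundary points are represented once, with flag \<open>True\<close>.  A set is open in
  the double iff its preimages in both copies are open.  The charts of the double extend those of
  the surface by Schwarz reflection.\<close>

definition sheet :: "('a, 'i) surface \<Rightarrow> bool \<Rightarrow> 'a \<Rightarrow> 'a \<times> bool" where
  "sheet Y b p = (p, b \<or> p \<in> bd Y)"

definition double :: "('a, 'i) surface \<Rightarrow> ('a \<times> bool, 'i) surface" where
  "double Y =
     \<lparr> surf_top = topology (\<lambda>W. W \<subseteq> (\<Union>b. sheet Y b ` topspace (surf_top Y)) \<and>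
         (\<forall>b. openin (surf_top Y) {p \<in> topspace (surf_top Y). sheet Y b p \<in> W})),
       idx = idx Y,
       cdom = (\<lambda>i. \<Union>b. sheet Y b ` cdom Y i),
       chart = (\<lambda>i (p, b). if b then chart Y i p else cnj (chart Y i p)) \<rparr>"

text \<open>On the boundary \<open>d(chart i)\<close> is a positive one-form for the boundary orientation, so the real
  elements of the spin bundle there are those with real coefficients and \<open>s i j\<close> is real.
  Doubling with respect to this real structure therefore conjugates the cocycle on the other copy.\<close>

definition double_spin ::
  "('i \<Rightarrow> 'i \<Rightarrow> 'a \<Rightarrow> complex) \<Rightarrow> 'i \<Rightarrow> 'i \<Rightarrow> 'a \<times> bool \<Rightarrow> complex" where
  "double_spin s i j = (\<lambda>(p, b). if b then s i j p else cnj (s i j p))"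

section \<open>The Cauchy-Riemann operator on a surface without boundary\<close>

primrec C_k_on :: "nat \<Rightarrow> (complex \<Rightarrow> complex) \<Rightarrow> complex set \<Rightarrow> bool" where
  "C_k_on 0 f V \<longleftrightarrow> continuous_on V f"
| "C_k_on (Suc n) f V \<longleftrightarrow> (\<forall>z\<in>V. f differentiable (at z)) \<and>
     C_k_on n (\<lambda>z. frechet_derivative f (at z) 1) V \<and>
     C_k_on n (\<lambda>z. frechet_derivative f (at z) \<i>) V"

definition smooth_on :: "(complex \<Rightarrow> complex) \<Rightarrow> complex set \<Rightarrow> bool" where
  "smooth_on f V \<longleftrightarrow> (\<forall>n. C_k_on n f V)"

text \<open>Families of coefficients are normalised to vanish outside the chart domains, so that equal
  sections are equal families.\<close>

definition supported :: "('a, 'i) surface \<Rightarrow> ('i \<Rightarrow> 'a \<Rightarrow> complex) \<Rightarrow> bool" where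
  "supported Z f \<longleftrightarrow> (\<forall>i p. \<not> (i \<in> idx Z \<and> p \<in> cdom Z i) \<longrightarrow> f i p = 0)"

definition smooth_sections ::
  "('a, 'i) surface \<Rightarrow> ('i \<Rightarrow> 'i \<Rightarrow> 'a \<Rightarrow> complex) \<Rightarrow> ('i \<Rightarrow> 'a \<Rightarrow> complex) set" where
  "smooth_sections Z t = {f. supported Z f \<and> section_over Z t UNIV f \<and>
     (\<forall>i\<in>idx Z. smooth_on (f i \<circ> inv_chart Z i) (chart Z i ` cdom Z i))}"

text \<open>Smooth (0,1)-forms with values in the spin bundle: coefficients of
  \<open>e i \<otimes> cnj (d(chart i))\<close>.\<close>

definition smooth_01_forms ::
  "('a, 'i) surface \<Rightarrow> ('i \<Rightarrow> 'i \<Rightarrow> 'a \<Rightarrow> complex) \<Rightarrow> ('i \<Rightarrow> 'a \<Rightarrow> complex) set" where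
  "smooth_01_forms Z t = {g. supported Z g \<and>
     section_over Z (\<lambda>i j p. t i j p * cnj ((t i j p)\<^sup>2)) UNIV g \<and>
     (\<forall>i\<in>idx Z. smooth_on (g i \<circ> inv_chart Z i) (chart Z i ` cdom Z i))}"

definition dbar_coord :: "(complex \<Rightarrow> complex) \<Rightarrow> complex \<Rightarrow> complex" where
  "dbar_coord F z = (frechet_derivative F (at z) 1 + \<i> * frechet_derivative F (at z) \<i>) / 2"

definition dbar :: "('a, 'i) surface \<Rightarrow> ('i \<Rightarrow> 'a \<Rightarrow> complex) \<Rightarrow> 'i \<Rightarrow> 'a \<Rightarrow> complex" where
  "dbar Z f i p = (if i \<in> idx Z \<and> p \<in> cdom Z i
     then dbar_coord (f i \<circ> inv_chart Z i) (chart Z i p) else 0)"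

definition dbar_invertible ::
  "('a, 'i) surface \<Rightarrow> ('i \<Rightarrow> 'i \<Rightarrow> 'a \<Rightarrow> complex) \<Rightarrow> bool" where
  "dbar_invertible Z t \<longleftrightarrow> bij_betw (dbar Z) (smooth_sections Z t) (smooth_01_forms Z t)"

section \<open>Measure and integration on the boundary\<close>

definition real_trace :: "('a, 'i) surface \<Rightarrow> 'i \<Rightarrow> 'a set \<Rightarrow> real set" where
  "real_trace Y i E = {x. complex_of_real x \<in> chart Y i ` (cdom Y i \<inter> E)}"

definition bd_measurable :: "('a, 'i) surface \<Rightarrow> ('i \<Rightarrow> 'a \<Rightarrow> 'v::topological_space) \<Rightarrow> bool" where
  "bd_measurable Y h \<longleftrightarrow> (\<forall>i\<in>idx Y. (\<lambda>x. h i (inv_chart Y i (complex_of_real x)))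
     \<in> borel_measurable (lebesgue_on (real_trace Y i (bd Y))))"

definition AE_bd :: "('a, 'i) surface \<Rightarrow> ('a \<Rightarrow> bool) \<Rightarrow> bool" where
  "AE_bd Y P \<longleftrightarrow> (\<forall>i\<in>idx Y. AE x in lebesgue.
     x \<in> real_trace Y i (bd Y) \<longrightarrow> P (inv_chart Y i (complex_of_real x)))"

text \<open>A one-density on the boundary has coefficients \<open>\<rho> i\<close> with respect to \<open>\<bar>d(chart i)\<bar>\<close>.  It is
  integrated by cutting the (compact) boundary into pieces lying in finitely many charts; for
  one-densities the result does not depend on the chosen charts.\<close>

definition bd_cover :: "('a, 'i) surface \<Rightarrow> 'i list" where
  "bd_cover Y = (SOME l. set l \<subseteq> idx Y \<and> bd Y \<subseteq> (\<Union>i\<in>set l. cdom Y i))"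

definition bd_piece :: "('a, 'i) surface \<Rightarrow> nat \<Rightarrow> 'a set" where
  "bd_piece Y n = (bd Y \<inter> cdom Y (bd_cover Y ! n)) - (\<Union>m<n. cdom Y (bd_cover Y ! m))"

definition bd_integrable :: "('a, 'i) surface \<Rightarrow> ('i \<Rightarrow> 'a \<Rightarrow> complex) \<Rightarrow> bool" where
  "bd_integrable Y \<rho> \<longleftrightarrow> (\<forall>n<length (bd_cover Y). let i = bd_cover Y ! n in
     set_integrable lebesgue (real_trace Y i (bd_piece Y n))
       (\<lambda>x. \<rho> i (inv_chart Y i (complex_of_real x))))"

definition bd_integral :: "('a, 'i) surface \<Rightarrow> ('i \<Rightarrow> 'a \<Rightarrow> complex) \<Rightarrow> complex" where
  "bd_integral Y \<rho> = (\<Sum>n<length (bd_cover Y). let i = bd_cover Y ! n in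
     LINT x : real_trace Y i (bd_piece Y n) | lebesgue. \<rho> i (inv_chart Y i (complex_of_real x)))"

section \<open>The space of square integrable boundary spinors\<close>

definition section2_over :: "('a, 'i) surface \<Rightarrow> ('i \<Rightarrow> 'i \<Rightarrow> 'a \<Rightarrow> complex) \<Rightarrow> 'a set \<Rightarrow>
    ('i \<Rightarrow> 'a \<Rightarrow> complex ^ 2) \<Rightarrow> bool" where
  "section2_over Y s W f \<longleftrightarrow> (\<forall>l. section_over Y s W (\<lambda>i p. f i p $ l))"

text \<open>Elements of the Hilbert space are represented by square integrable sections, equality in the
  Hilbert space being \<open>ae_eq\<close>.\<close>

definition L2_bd :: "('a, 'i) surface \<Rightarrow> ('i \<Rightarrow> 'i \<Rightarrow> 'a \<Rightarrow> complex) \<Rightarrow>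
    ('i \<Rightarrow> 'a \<Rightarrow> complex ^ 2) set" where
  "L2_bd Y s = {\<psi>. section2_over Y s (bd Y) \<psi> \<and> bd_measurable Y \<psi> \<and>
     bd_integrable Y (\<lambda>i p. complex_of_real ((norm (\<psi> i p))\<^sup>2))}"

definition ae_eq :: "('a, 'i) surface \<Rightarrow> ('i \<Rightarrow> 'a \<Rightarrow> complex ^ 2) \<Rightarrow>
    ('i \<Rightarrow> 'a \<Rightarrow> complex ^ 2) \<Rightarrow> bool" where
  "ae_eq Y \<psi> \<phi> \<longleftrightarrow> AE_bd Y (\<lambda>p. \<forall>i\<in>idx Y. p \<in> cdom Y i \<longrightarrow> \<psi> i p = \<phi> i p)"

definition inner_bd :: "('a, 'i) surface \<Rightarrow> ('i \<Rightarrow> 'a \<Rightarrow> complex ^ 2) \<Rightarrow>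
    ('i \<Rightarrow> 'a \<Rightarrow> complex ^ 2) \<Rightarrow> complex" where
  "inner_bd Y \<psi> \<phi> = bd_integral Y (\<lambda>i p. \<Sum>l\<in>UNIV. \<psi> i p $ l * cnj (\<phi> i p $ l))"

definition norm_bd :: "('a, 'i) surface \<Rightarrow> ('i \<Rightarrow> 'a \<Rightarrow> complex ^ 2) \<Rightarrow> real" where
  "norm_bd Y \<psi> = sqrt (Re (inner_bd Y \<psi> \<psi>))"

section \<open>Boundary values\<close>

text \<open>Boundary values are taken in the classical sense: nontangential limits almost everywhere of
  coefficients that stay bounded near the boundary.  Boundedness cannot be dropped.  On the unit
  disc, the reciprocal of a singular inner function has unimodular nontangential limits almost
  everywhere, but multiplication by them does not preserve the Hardy space.  Every function of
  Hardy class with bounded boundary values is bounded.\<close>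

definition has_boundary_value :: "('a, 'i) surface \<Rightarrow>
    ('i \<Rightarrow> 'a \<Rightarrow> 'v::real_normed_vector) \<Rightarrow> ('i \<Rightarrow> 'a \<Rightarrow> 'v) \<Rightarrow> bool" where
  "has_boundary_value Y f \<psi> \<longleftrightarrow>
     (\<forall>i\<in>idx Y. \<forall>p \<in> cdom Y i \<inter> bd Y. \<exists>e>0. \<exists>B. \<forall>q \<in> cdom Y i - bd Y.
        cmod (chart Y i q - chart Y i p) < e \<longrightarrow> norm (f i q) \<le> B) \<and>
     AE_bd Y (\<lambda>p. \<forall>i\<in>idx Y. p \<in> cdom Y i \<longrightarrow> (\<forall>M>0.
        ((\<lambda>z. f i (inv_chart Y i z)) \<longlongrightarrow> \<psi> i p)
          (at (chart Y i p) within
             {z \<in> chart Y i ` (cdom Y i - bd Y). \<bar>Re z - Re (chart Y i p)\<bar> \<le> M * Im z})))"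

definition holomorphic_section2 :: "('a, 'i) surface \<Rightarrow> ('i \<Rightarrow> 'i \<Rightarrow> 'a \<Rightarrow> complex) \<Rightarrow>
    ('i \<Rightarrow> 'a \<Rightarrow> complex ^ 2) \<Rightarrow> bool" where
  "holomorphic_section2 Y s f \<longleftrightarrow> section2_over Y s (- bd Y) f \<and>
     (\<forall>i\<in>idx Y. \<forall>l. (\<lambda>z. f i (inv_chart Y i z) $ l) holomorphic_on chart Y i ` (cdom Y i - bd Y))"

definition holomorphic_boundary_value :: "('a, 'i) surface \<Rightarrow> ('a \<Rightarrow> complex) \<Rightarrow> bool" where
  "holomorphic_boundary_value Y a \<longleftrightarrow>
     (\<exists>F. (\<forall>i\<in>idx Y. (F \<circ> inv_chart Y i) holomorphic_on chart Y i ` (cdom Y i - bd Y)) \<and>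
          has_boundary_value Y (\<lambda>i. F) (\<lambda>i. a))"

section \<open>The Hardy space and the compression of multiplication operators\<close>

definition H_plus :: "('a, 'i) surface \<Rightarrow> ('i \<Rightarrow> 'i \<Rightarrow> 'a \<Rightarrow> complex) \<Rightarrow>
    ('i \<Rightarrow> 'a \<Rightarrow> complex ^ 2) set" where
  "H_plus Y s = {\<psi> \<in> L2_bd Y s. \<forall>e>0. \<exists>f. \<exists>\<phi>\<in>L2_bd Y s.
     holomorphic_section2 Y s f \<and> has_boundary_value Y f \<phi> \<and>
     norm_bd Y (\<lambda>i p. \<psi> i p - \<phi> i p) < e}"

definition mult_op :: "('a \<Rightarrow> complex ^ 2 ^ 2) \<Rightarrow> ('i \<Rightarrow> 'a \<Rightarrow> complex ^ 2) \<Rightarrow>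
    'i \<Rightarrow> 'a \<Rightarrow> complex ^ 2" where
  "mult_op g \<psi> = (\<lambda>i p. g p *v \<psi> i p)"

text \<open>The compression to \<open>H_plus\<close>: multiply, then project orthogonally to \<open>H_plus\<close>, that is, take the
  (almost everywhere unique) element of \<open>H_plus\<close> from which the product differs by a vector
  orthogonal to \<open>H_plus\<close>.  The complementary summand \<open>H_minus\<close> of the polarization, the closure
  of the boundary values from the reversed copy, is the orthogonal complement of \<open>H_plus\<close>: for a
  holomorphic \<open>\<psi>\<close> on the surface and \<open>\<phi>\<close> on the reversed copy, \<open>\<psi> * cnj \<phi>\<close> extends to a holomorphic
  one-form, whose boundary integral vanishes.  Hence this is the block of the multiplication
  operator with respect to the polarization.\<close>

definition A_op :: "('a, 'i) surface \<Rightarrow> ('i \<Rightarrow> 'i \<Rightarrow> 'a \<Rightarrow> complex) \<Rightarrow>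
    ('a \<Rightarrow> complex ^ 2 ^ 2) \<Rightarrow> ('i \<Rightarrow> 'a \<Rightarrow> complex ^ 2) \<Rightarrow> 'i \<Rightarrow> 'a \<Rightarrow> complex ^ 2" where
  "A_op Y s g \<psi> = (SOME \<xi>. \<xi> \<in> H_plus Y s \<and>
     (\<forall>\<eta>\<in>H_plus Y s. inner_bd Y (\<lambda>i p. mult_op g \<psi> i p - \<xi> i p) \<eta> = 0))"

section \<open>Matrices\<close>

definition hermitian_adjoint :: "complex ^ 2 ^ 2 \<Rightarrow> complex ^ 2 ^ 2" where
  "hermitian_adjoint m = (\<chi> i j. cnj (m $ j $ i))"

definition SU2 :: "(complex ^ 2 ^ 2) set" where
  "SU2 = {m. m ** hermitian_adjoint m = mat 1 \<and> det m = 1}"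

definition measurable_multiloop :: "('a, 'i) surface \<Rightarrow> ('a \<Rightarrow> complex ^ 2 ^ 2) \<Rightarrow> bool" where
  "measurable_multiloop Y k \<longleftrightarrow> bd_measurable Y (\<lambda>i. k) \<and> (\<forall>p\<in>bd Y. k p \<in> SU2)"

end

theory Submission
  imports Defs "HOL-Library.Function_Algebras"
begin

text \<open>Put \<open>\<eta> = k2 \<psi> - A(k2) \<psi>\<close>, which is orthogonal to \<open>H_plus\<close>.  The second row of \<open>k2\<close> is
  holomorphic, so the second component of \<open>\<eta>\<close> also lies in \<open>H_plus\<close> and hence vanishes.  Against
  \<open>h \<in> H_plus\<close> the product \<open>k1* \<eta>\<close> therefore only sees the first component of \<open>k1 h\<close>, which is in
  \<open>H_plus\<close> since the first row of \<open>k1\<close> is holomorphic.  So \<open>k1* \<eta>\<close> is orthogonal to \<open>H_plus\<close>, and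
  \<open>k1* k2 \<psi>\<close> and \<open>k1* A(k2) \<psi>\<close> have the same projection.

  That the projections exist requires a Riesz-Fischer argument for boundary spinors: the limit is
  taken pointwise, which preserves the cocycle condition.  That they are unique almost everywhere in
  every chart, although the integral only sees the charts of a finite cover, holds because transition
  functions are real and differentiable along the boundary and so preserve null sets.\<close>

text \<open>\<open>A_op\<close> is a \<open>SOME\<close> term: nothing holds of it until a
  projection exists, and since sections are families of functions and not classes, it is determined
  only up to a null section. The Hilbert space theory is therefore done for a semi-definite form on
  a subspace of all families with pointwise operations, and "vanishes" means having length zero. The
  form is the real part \<open>ip\<close> of \<open>inner_bd\<close>; as \<open>H_plus\<close> is
  stable under multiplication by \<open>\<i>\<close>, real and Hermitian orthogonality to it
  coincide. Stability of \<open>H_plus\<close> under multiplication is shown once, for measurable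
  matrix functions whose entries are bounded holomorphic boundary values. Real scalars,
  \<open>\<i>\<close>, coordinate projections and the holomorphic rows of \<open>k1\<close> and
  \<open>k2\<close> are all instances. Two bounds make this work: boundary values come with
  extensions that are bounded near the boundary, so a product of extensions is again admissible, and
  entries of matrices in SU(2) have modulus at most 1, so multiplication is continuous in mean
  square.\<close>

instantiation "fun" :: (type, real_vector) real_vector
begin

definition "c *\<^sub>R f = (\<lambda>x. c *\<^sub>R f x)"

instance
  by standard (simp_all add: scaleR_fun_def fun_eq_iff algebra_simps)

end

lemma scaleR_fun_apply [simp]: "(c *\<^sub>R f) x = c *\<^sub>R f x"
  by (simp add: scaleR_fun_def)

section \<open>Orthogonal projection for a semi-definite inner product\<close>

text \<open>A section that vanishes almost everywhere has length zero without being zero, so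
  definiteness is not asked for. The laws are confined to \<open>V\<close> because integrals are
  additive only on integrable functions.\<close>

locale semi_inner =
  fixes V :: "'v::real_vector set" and ip :: "'v \<Rightarrow> 'v \<Rightarrow> real"
  assumes subspace_V: "subspace V"
    and ip_add_left: "\<lbrakk>x \<in> V; y \<in> V; z \<in> V\<rbrakk> \<Longrightarrow> ip (x + y) z = ip x z + ip y z"
    and ip_scale_left: "\<lbrakk>x \<in> V; z \<in> V\<rbrakk> \<Longrightarrow> ip (r *\<^sub>R x) z = r * ip x z"
    and ip_sym: "\<lbrakk>x \<in> V; y \<in> V\<rbrakk> \<Longrightarrow> ip x y = ip y x"
    and ip_nonneg: "x \<in> V \<Longrightarrow> 0 \<le> ip x x"
begin

lemmas V_intros = subspace_add[OF subspace_V] subspace_diff[OF subspace_V]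
  subspace_scale[OF subspace_V] subspace_0[OF subspace_V] subspace_neg[OF subspace_V]

lemma ip_add_right: "\<lbrakk>x \<in> V; y \<in> V; z \<in> V\<rbrakk> \<Longrightarrow> ip z (x + y) = ip z x + ip z y"
  by (metis ip_add_left ip_sym V_intros(1))

lemma ip_scale_right: "\<lbrakk>x \<in> V; z \<in> V\<rbrakk> \<Longrightarrow> ip z (r *\<^sub>R x) = r * ip z x"
  by (metis ip_scale_left ip_sym V_intros(3))

lemma ip_diff_left: "\<lbrakk>x \<in> V; y \<in> V; z \<in> V\<rbrakk> \<Longrightarrow> ip (x - y) z = ip x z - ip y z"
  using ip_add_left[of x "- 1 *\<^sub>R y" z] ip_scale_left[of y z "-1"] V_intros(5)[of y] by simp

lemma ip_diff_right: "\<lbrakk>x \<in> V; y \<in> V; z \<in> V\<rbrakk> \<Longrightarrow> ip z (x - y) = ip z x - ip z y"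
  by (metis ip_diff_left ip_sym V_intros(2))

lemmas ip_simps = ip_add_left ip_add_right ip_diff_left ip_diff_right ip_scale_left ip_scale_right

lemma ip_norm_add_le:
  assumes "x \<in> V" "y \<in> V"
  shows "ip (x + y) (x + y) \<le> 2 * ip x x + 2 * ip y y"
proof -
  have "0 \<le> ip (x - y) (x - y)" using assms by (intro ip_nonneg V_intros)
  then show ?thesis using assms by (simp add: ip_simps V_intros ip_sym[of y x])
qed

text \<open>The squared length of \<open>x - t *\<^sub>R y\<close> is a nonnegative quadratic
  polynomial in \<open>t\<close>. It degenerates to an affine function when \<open>y\<close> is
  null, hence the case distinction.\<close>

lemma Cauchy_Schwarz:
  assumes x: "x \<in> V" and y: "y \<in> V"
  shows "(ip x y)\<^sup>2 \<le> ip x x * ip y y"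
proof -
  have quad: "0 \<le> ip x x - 2 * t * ip x y + t\<^sup>2 * ip y y" for t
  proof -
    have "0 \<le> ip (x - t *\<^sub>R y) (x - t *\<^sub>R y)" using x y by (intro ip_nonneg V_intros)
    also have "\<dots> = ip x x - 2 * t * ip x y + t\<^sup>2 * ip y y"
      using x y by (simp add: ip_simps V_intros ip_sym[of y x] algebra_simps power2_eq_square)
    finally show ?thesis .
  qed
  show ?thesis
  proof (cases "ip y y = 0")
    case True
    have "ip x y = 0"
    proof (rule ccontr)
      assume "ip x y \<noteq> 0"
      \<comment> \<open>At this \<open>t\<close> the affine function takes the value -1.\<close>
      then show False using quad[of "(ip x x + 1) / (2 * ip x y)"] True ip_nonneg[OF x] by simp
    qed
    then show ?thesis using True by simp
  next
    case False
    then have "ip y y > 0" using ip_nonneg[OF y] by simp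
    \<comment> \<open>This \<open>t\<close> is the minimum of the quadratic polynomial.\<close>
    then show ?thesis using quad[of "ip x y / ip y y"]
      by (simp add: field_simps power2_eq_square)
  qed
qed

lemma ip_eq_0_if_null: "\<lbrakk>x \<in> V; y \<in> V; ip x x = 0\<rbrakk> \<Longrightarrow> ip x y = 0"
  using Cauchy_Schwarz[of x y] by simp

text \<open>A minimising sequence is Cauchy by the parallelogram law, and its limit is a projection
  by a first variation argument. Completeness is a hypothesis about sequences of geometric rate
  only, the form in which the Riesz-Fischer argument supplies it: consecutive distances are then at
  most \<open>(1/2) ^ n\<close>, which is summable.\<close>

lemma projection_exists:
  assumes H: "subspace H" "H \<subseteq> V" and g: "g \<in> V"
    and complete: "\<And>h. \<lbrakk>\<And>n. h n \<in> H; \<And>m n. n \<le> m \<Longrightarrow> ip (h m - h n) (h m - h n) \<le> (1/4) ^ n\<rbrakk>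
      \<Longrightarrow> \<exists>\<xi>\<in>H. (\<lambda>n. ip (h n - \<xi>) (h n - \<xi>)) \<longlonglongrightarrow> 0"
  shows "\<exists>\<xi>\<in>H. \<forall>\<eta>\<in>H. ip (g - \<xi>) \<eta> = 0"
proof -
  define \<delta> where "\<delta> = (INF h\<in>H. ip (g - h) (g - h))"
  have HV: "h \<in> V" if "h \<in> H" for h using that H by auto
  have bdd: "bdd_below ((\<lambda>h. ip (g - h) (g - h)) ` H)"
    by (rule bdd_belowI[of _ 0]) (use g HV V_intros(2) ip_nonneg in blast)
  have lower: "\<delta> \<le> ip (g - h) (g - h)" if "h \<in> H" for h
    unfolding \<delta>_def using that bdd by (intro cINF_lower) auto
  \<comment> \<open>The extra factor 1/4 pays for the coefficient 2 of each of the two squared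
    distances in the parallelogram law.\<close>
  have "\<exists>h\<in>H. ip (g - h) (g - h) < \<delta> + (1/4) ^ n / 4" for n :: nat
  proof (rule ccontr)
    assume "\<not> ?thesis"
    then have "\<delta> + (1/4) ^ n / 4 \<le> \<delta>"
      unfolding \<delta>_def using subspace_0[OF H(1)] by (intro cINF_greatest) (auto simp: not_less)
    then show False using zero_less_power[of "1/4 :: real" n] by linarith
  qed
  then obtain h where hH: "\<And>n. h n \<in> H"
    and near: "\<And>n. ip (g - h n) (g - h n) < \<delta> + (1/4) ^ n / 4" by metis
  have gV: "g - h n \<in> V" for n by (intro V_intros g HV hH)
  have "ip (h m - h n) (h m - h n) \<le> (1/4) ^ n" if "n \<le> m" for m n
  proof -
    define x y where "x = g - h m" and "y = g - h n"
    have xy: "x \<in> V" "y \<in> V" using gV by (auto simp: x_def y_def)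
    \<comment> \<open>The midpoint lies in \<open>H\<close>, so it cannot be closer to
      \<open>g\<close> than \<open>\<delta>\<close> allows; this forces \<open>h m\<close> and
      \<open>h n\<close> together.\<close>
    have "(1/2) *\<^sub>R (h m + h n) \<in> H" by (intro subspace_add subspace_scale H(1) hH)
    from lower[OF this] have "\<delta> \<le> ip ((1/2) *\<^sub>R (x + y)) ((1/2) *\<^sub>R (x + y))"
      by (simp add: x_def y_def algebra_simps flip: scaleR_2)
    also have "\<dots> = ip (x + y) (x + y) / 4"
      using xy by (simp add: ip_scale_left ip_scale_right V_intros)
    also have "\<dots> = (2 * ip x x + 2 * ip y y - ip (y - x) (y - x)) / 4"
      using xy by (simp add: ip_simps V_intros ip_sym[of y x])
    finally have "ip (h m - h n) (h m - h n) \<le> 2 * ip x x + 2 * ip y y - 4 * \<delta>"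
      by (simp add: x_def y_def)
    also have "\<dots> \<le> (1/4) ^ m / 2 + (1/4) ^ n / 2"
      using near[of m] near[of n] by (simp add: x_def y_def)
    also have "\<dots> \<le> (1/4) ^ n" using power_decreasing[OF that, of "1/4 :: real"] by linarith
    finally show ?thesis .
  qed
  from complete[OF hH this] obtain \<xi> where \<xi>: "\<xi> \<in> H"
    and lim: "(\<lambda>n. ip (h n - \<xi>) (h n - \<xi>)) \<longlonglongrightarrow> 0" by blast
  have "ip (g - \<xi>) \<eta> = 0" if \<eta>: "\<eta> \<in> H" for \<eta>
  proof -
    define c K where "c = ip (g - \<xi>) \<eta>" and "K = ip \<eta> \<eta>"
    have hx: "h n - \<xi> \<in> V" for n by (intro V_intros HV hH \<xi>)
    have "(\<lambda>n. ip (h n - \<xi>) \<eta>) \<longlonglongrightarrow> 0"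
    proof (rule Lim_null_comparison)
      show "\<forall>\<^sub>F n in sequentially. norm (ip (h n - \<xi>) \<eta>) \<le> sqrt (ip (h n - \<xi>) (h n - \<xi>) * K)"
        using Cauchy_Schwarz[OF hx HV[OF \<eta>]]
        by (intro always_eventually allI real_le_rsqrt) (simp add: K_def)
      show "(\<lambda>n. sqrt (ip (h n - \<xi>) (h n - \<xi>) * K)) \<longlonglongrightarrow> 0"
        using tendsto_real_sqrt[OF tendsto_mult_right[OF lim, of K]] by simp
    qed
    from tendsto_diff[OF tendsto_const[of c] this]
    have lim_c: "(\<lambda>n. ip (g - h n) \<eta>) \<longlonglongrightarrow> c"
      using g HV[OF hH] HV[OF \<xi>] HV[OF \<eta>] by (simp add: c_def ip_simps)
    \<comment> \<open>First variation: moving \<open>h n\<close> by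
      \<open>t *\<^sub>R \<eta>\<close> stays in \<open>H\<close> and so cannot bring the squared
      distance below \<open>\<delta>\<close>.\<close>
    have quad: "2 * t * c \<le> t\<^sup>2 * K" for t
    proof -
      have A: "2 * t * ip (g - h n) \<eta> \<le> (1/4) ^ n / 4 + t\<^sup>2 * K" for n
      proof -
        have "h n + t *\<^sub>R \<eta> \<in> H" by (intro subspace_add subspace_scale H(1) hH \<eta>)
        from lower[OF this] have "\<delta> \<le> ip ((g - h n) - t *\<^sub>R \<eta>) ((g - h n) - t *\<^sub>R \<eta>)"
          by (simp add: algebra_simps)
        also have "\<dots> = ip (g - h n) (g - h n) - 2 * t * ip (g - h n) \<eta> + t\<^sup>2 * K"
          unfolding K_def using gV[of n] HV[OF \<eta>] ip_sym[OF HV[OF \<eta>] gV[of n]]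
          by (simp add: ip_diff_left[of "g - h n"] ip_diff_right[of "g - h n"] ip_scale_left
            ip_scale_right V_intros power2_eq_square right_diff_distrib)
        finally show ?thesis using near[of n] by simp
      qed
      have "(\<lambda>n. (1/4) ^ n / 4 + t\<^sup>2 * K) \<longlonglongrightarrow> 0 / 4 + t\<^sup>2 * K"
        by (intro tendsto_intros LIMSEQ_power_zero) simp_all
      moreover have "(\<lambda>n. 2 * t * ip (g - h n) \<eta>) \<longlonglongrightarrow> 2 * t * c" by (intro tendsto_intros lim_c)
      ultimately show ?thesis using A by (intro LIMSEQ_le[where y = "t\<^sup>2 * K"]) auto
    qed
    have "K \<ge> 0" using ip_nonneg HV[OF \<eta>] by (simp add: K_def)
    \<comment> \<open>Dividing by \<open>K + 1\<close> instead of \<open>K\<close> also covers a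
      null \<open>\<eta>\<close>.\<close>
    define t where "t = c / (K + 1)"
    have c: "c = t * (K + 1)" using \<open>K \<ge> 0\<close> by (simp add: t_def)
    have "t\<^sup>2 * (K + 2) \<le> 0" using quad[of t] unfolding c by (simp add: power2_eq_square algebra_simps)
    then have "t = 0" using \<open>K \<ge> 0\<close> by (auto simp: mult_le_0_iff)
    then show ?thesis using c by (simp add: c_def)
  qed
  with \<xi> show ?thesis by blast
qed

end

section \<open>Mean square convergence\<close>

text \<open>The weight \<open>2 ^ k\<close> is small enough for the weighted squares to have
  summable integrals, \<open>(2/4) ^ k\<close>, and large enough that a bound on their pointwise sum
  makes the increments absolutely summable. Unlike a passage to the first-power norm, this also
  works on pieces of infinite length.\<close>

lemma AE_convergent_if_fast_L2:
  fixes f :: "nat \<Rightarrow> 'x \<Rightarrow> 'b::{banach, second_countable_topology}"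
  assumes meas: "\<And>k. f k \<in> borel_measurable M"
    and fast: "\<And>k. (\<integral>\<^sup>+ x. ennreal ((norm (f (Suc k) x - f k x))\<^sup>2) \<partial>M) \<le> ennreal ((1/4) ^ k)"
  shows "AE x in M. convergent (\<lambda>k. f k x)"
proof -
  note [measurable] = meas
  have "(\<integral>\<^sup>+ x. (\<Sum>k. ennreal (2 ^ k * (norm (f (Suc k) x - f k x))\<^sup>2)) \<partial>M) =
      (\<Sum>k. \<integral>\<^sup>+ x. ennreal (2 ^ k * (norm (f (Suc k) x - f k x))\<^sup>2) \<partial>M)"
    by (rule nn_integral_suminf) measurable
  also have "\<dots> = (\<Sum>k. ennreal (2 ^ k) * (\<integral>\<^sup>+ x. ennreal ((norm (f (Suc k) x - f k x))\<^sup>2) \<partial>M))"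
    by (subst nn_integral_cmult[symmetric]) (auto simp: ennreal_mult)
  also have "\<dots> \<le> (\<Sum>k. ennreal ((1/2) ^ k))"
  proof (rule suminf_le)
    fix k
    have "ennreal (2 ^ k) * (\<integral>\<^sup>+ x. ennreal ((norm (f (Suc k) x - f k x))\<^sup>2) \<partial>M)
        \<le> ennreal (2 ^ k) * ennreal ((1/4) ^ k)"
      by (intro mult_left_mono fast) simp
    also have "\<dots> = ennreal ((1/2) ^ k)"
      by (simp add: ennreal_mult[symmetric] power_mult_distrib[symmetric])
    finally show "ennreal (2 ^ k) * (\<integral>\<^sup>+ x. ennreal ((norm (f (Suc k) x - f k x))\<^sup>2) \<partial>M)
        \<le> ennreal ((1/2) ^ k)" .
  qed auto
  finally have "(\<integral>\<^sup>+ x. (\<Sum>k. ennreal (2 ^ k * (norm (f (Suc k) x - f k x))\<^sup>2)) \<partial>M)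
      \<le> (\<Sum>k. ennreal ((1/2) ^ k))" .
  moreover have "(\<Sum>k. ennreal ((1/2) ^ k)) \<noteq> top"
    by (intro ennreal_suminf_neq_top summable_geometric) auto
  ultimately have fin: "(\<integral>\<^sup>+ x. (\<Sum>k. ennreal (2 ^ k * (norm (f (Suc k) x - f k x))\<^sup>2)) \<partial>M) \<noteq> \<infinity>"
    by (metis infinity_ennreal_def neq_top_trans)
  have "AE x in M. (\<Sum>k. ennreal (2 ^ k * (norm (f (Suc k) x - f k x))\<^sup>2)) \<noteq> \<infinity>"
    by (rule nn_integral_noteq_infinite[OF _ fin]) measurable
  then show ?thesis
  proof eventually_elim
    case (elim x)
    let ?d = "\<lambda>k. f (Suc k) x - f k x"
    have "summable (\<lambda>k. 2 ^ k * (norm (?d k))\<^sup>2)"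
      by (rule summable_suminf_not_top[OF _ elim[unfolded infinity_ennreal_def]]) simp
    then have summ: "summable (\<lambda>k. 2 ^ k * (norm (?d k))\<^sup>2 + (1/2) ^ k)"
      by (rule summable_add) (rule summable_geometric, simp)
    have "norm (?d k) \<le> 2 ^ k * (norm (?d k))\<^sup>2 + (1/2) ^ k" for k
    proof -
      \<comment> \<open>AM-GM with weight \<open>2 ^ k\<close>\<close>
      define p u :: real where "p = 2 ^ k" and "u = norm (?d k)"
      have p: "p > 0" and u: "u \<ge> 0" by (simp_all add: p_def u_def)
      have "0 \<le> (p * u - 1)\<^sup>2" by simp
      then have "2 * (p * u) \<le> p * (p * u\<^sup>2) + 1" by (simp add: power2_eq_square algebra_simps)
      moreover have "0 \<le> p * u" using p u by simp
      ultimately have "p * u \<le> p * (p * u\<^sup>2 + 1 / p)" using p by (simp add: distrib_left)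
      then have "u \<le> p * u\<^sup>2 + 1 / p" using p by (simp only: mult_le_cancel_left_pos)
      then show ?thesis by (simp add: p_def u_def power_one_over)
    qed
    then have "summable ?d"
      using summable_comparison_test'[OF summ, of 0 ?d] by blast
    then have "convergent (\<lambda>n. (\<Sum>k<n. ?d k) + f 0 x)"
      by (intro convergent_add convergent_const) (simp add: summable_iff_convergent)
    then show ?case by (simp add: sum_lessThan_telescope[of "\<lambda>k. f k x"])
  qed
qed

text \<open>Fatou's lemma in the index \<open>m\<close> with \<open>n\<close> fixed. The nonnegative
  integral makes sense before \<open>g\<close> is known to be square integrable.\<close>

lemma nn_integral_norm_limit_le:
  fixes f :: "nat \<Rightarrow> 'x \<Rightarrow> 'b::{banach, second_countable_topology}"
  assumes meas: "\<And>k. f k \<in> borel_measurable M"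
    and lim: "AE x in M. (\<lambda>k. f k x) \<longlonglongrightarrow> g x"
    and bound: "\<And>m. n \<le> m \<Longrightarrow> (\<integral>\<^sup>+ x. ennreal ((norm (f m x - f n x))\<^sup>2) \<partial>M) \<le> C"
  shows "(\<integral>\<^sup>+ x. ennreal ((norm (g x - f n x))\<^sup>2) \<partial>M) \<le> C"
proof -
  note [measurable] = meas
  have "(\<integral>\<^sup>+ x. ennreal ((norm (g x - f n x))\<^sup>2) \<partial>M) =
      (\<integral>\<^sup>+ x. liminf (\<lambda>m. ennreal ((norm (f m x - f n x))\<^sup>2)) \<partial>M)"
    using lim
    by (intro nn_integral_cong_AE)
      (auto elim!: eventually_mono intro!: lim_imp_Liminf[symmetric] tendsto_intros tendsto_ennrealI)
  also have "\<dots> \<le> liminf (\<lambda>m. \<integral>\<^sup>+ x. ennreal ((norm (f m x - f n x))\<^sup>2) \<partial>M)"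
    by (rule nn_integral_liminf) measurable
  also have "\<dots> \<le> liminf (\<lambda>m. C)"
    by (rule Liminf_mono) (use bound in \<open>auto simp: eventually_sequentially\<close>)
  also have "\<dots> = C" by (simp add: Liminf_const)
  finally show ?thesis .
qed

section \<open>Charts at the boundary\<close>

locale bordered_spin_surface =
  fixes Y :: "('a, 'i) surface" and s :: "'i \<Rightarrow> 'i \<Rightarrow> 'a \<Rightarrow> complex"
  assumes surface: "compact_connected_bordered_riemann_surface Y"
    and spin: "spin_structure Y s"
begin

lemma openin_cdom: "i \<in> idx Y \<Longrightarrow> openin (surf_top Y) (cdom Y i)"
  using surface by (simp add: compact_connected_bordered_riemann_surface_def)

lemma chart_homeomorphic:
  "i \<in> idx Y \<Longrightarrow> homeomorphic_map (subtopology (surf_top Y) (cdom Y i))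
     (top_of_set (chart Y i ` cdom Y i)) (chart Y i)"
  using surface by (simp add: compact_connected_bordered_riemann_surface_def)

lemma inj_on_chart: "i \<in> idx Y \<Longrightarrow> inj_on (chart Y i) (cdom Y i)"
  using homeomorphic_imp_injective_map[OF chart_homeomorphic] openin_subset[OF openin_cdom]
  by (simp add: Int_absorb1)

lemma inv_chart_chart [simp]: "\<lbrakk>i \<in> idx Y; p \<in> cdom Y i\<rbrakk> \<Longrightarrow> inv_chart Y i (chart Y i p) = p"
  unfolding inv_chart_def by (rule the_inv_into_f_f[OF inj_on_chart])

lemma chart_image_open:
  assumes i: "i \<in> idx Y" and U: "openin (surf_top Y) U" "U \<subseteq> cdom Y i"
  shows "\<exists>W. open W \<and> chart Y i ` U = half_plane \<inter> W"
proof -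
  have "openin (subtopology (surf_top Y) (cdom Y i)) U"
    using U openin_open_subtopology[OF openin_cdom[OF i]] by blast
  then have "openin (top_of_set (chart Y i ` cdom Y i)) (chart Y i ` U)"
    using homeomorphic_imp_open_map[OF chart_homeomorphic[OF i]] by (simp add: open_map_def)
  also have "openin (top_of_set half_plane) (chart Y i ` cdom Y i)"
    using surface i by (simp add: compact_connected_bordered_riemann_surface_def)
  finally show ?thesis by (auto simp: openin_open)
qed

lemma overlap_open:
  assumes "i \<in> idx Y" "j \<in> idx Y"
  shows "\<exists>W. open W \<and> overlap Y i j = half_plane \<inter> W"
  unfolding overlap_def using assms
  by (intro chart_image_open openin_Int openin_cdom) auto

lemma transition_chart:
  "\<lbrakk>j \<in> idx Y; p \<in> cdom Y j\<rbrakk> \<Longrightarrow> transition Y i j (chart Y j p) = chart Y i p"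
  by (simp add: transition_def)

text \<open>By the open mapping theorem a transition function cannot send an interior point of the half
  plane to a boundary point.\<close>

lemma Im_chart_eq_0:
  assumes i: "i \<in> idx Y" "p \<in> cdom Y i" and j: "j \<in> idx Y" "p \<in> cdom Y j"
    and "Im (chart Y i p) = 0"
  shows "Im (chart Y j p) = 0"
proof (rule ccontr)
  assume nz: "Im (chart Y j p) \<noteq> 0"
  let ?w = "chart Y j p"
  obtain W where W: "open W" "overlap Y i j = half_plane \<inter> W" using overlap_open i j by metis
  obtain W' where W': "overlap Y j i = half_plane \<inter> W'" using overlap_open i j by metis
  have "?w \<in> overlap Y i j" using i j by (auto simp: overlap_def)
  \<comment> \<open>Intersecting with the open half plane turns a relatively open set into an open
    subset of the plane, as the open mapping theorem requires.\<close>
  define S where "S = W \<inter> {z. Im z > 0}"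
  have S: "open S" unfolding S_def using W by (intro open_Int open_halfspace_Im_gt)
  have wS: "?w \<in> S" using \<open>?w \<in> overlap Y i j\<close> nz unfolding W(2) by (auto simp: S_def half_plane_def)
  have sub: "S \<subseteq> overlap Y i j" unfolding W(2) by (auto simp: S_def half_plane_def)
  have "holomorphic_up_to (transition Y i j) (overlap Y i j)"
    using surface i j by (simp add: compact_connected_bordered_riemann_surface_def)
  then obtain F where F: "F analytic_on overlap Y i j" "\<forall>z\<in>overlap Y i j. F z = transition Y i j z"
    by (auto simp: holomorphic_up_to_def)
  have "inj_on F (overlap Y i j)"
    using F(2) inj_on_chart[OF i(1)] by (auto simp: inj_on_def overlap_def transition_chart j)
  then have "open (F ` S)"
    using F(1) sub S by (meson analytic_imp_holomorphic analytic_on_subset inj_on_subset open_mapping_thm3)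
  moreover have "F ?w = chart Y i p"
    using F(2) wS sub j by (auto simp: transition_chart)
  ultimately obtain e where e: "e > 0" "ball (chart Y i p) e \<subseteq> F ` S"
    by (metis wS imageI openE)
  \<comment> \<open>A point slightly below a real point would have to be a chart value, but chart
    values lie in the closed upper half plane.\<close>
  have "chart Y i p - \<i> * (e/2) \<in> ball (chart Y i p) e"
    using e(1) by (simp add: dist_norm norm_mult)
  then obtain z where z: "z \<in> S" "F z = chart Y i p - \<i> * (e/2)" using e(2) by (metis imageE subsetD)
  then have "z \<in> overlap Y i j" using sub by blast
  then have "F z \<in> chart Y i ` (cdom Y i \<inter> cdom Y j)"
    using F(2) by (auto simp: overlap_def transition_chart j)
  then have "F z \<in> overlap Y j i" unfolding overlap_def by (subst Int_commute)
  then have "Im (F z) \<ge> 0" unfolding W' by (auto simp: half_plane_def)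
  then show False using z(2) assms(5) e(1) by simp
qed

lemma Im_chart_bd: "\<lbrakk>p \<in> bd Y; i \<in> idx Y; p \<in> cdom Y i\<rbrakk> \<Longrightarrow> Im (chart Y i p) = 0"
  unfolding bd_def using Im_chart_eq_0 by blast

lemma real_traceE:
  assumes "i \<in> idx Y" "x \<in> real_trace Y i E"
  obtains p where "p \<in> cdom Y i" "p \<in> E" "p \<in> bd Y" "chart Y i p = of_real x"
    "inv_chart Y i (of_real x) = p"
proof -
  obtain p where p: "p \<in> cdom Y i" "p \<in> E" "chart Y i p = of_real x"
    using assms by (auto simp: real_trace_def)
  moreover have "p \<in> bd Y" unfolding bd_def using assms p by (auto intro!: bexI[of _ i])
  ultimately show ?thesis using that inv_chart_chart[OF assms(1) p(1)] by metis
qed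

lemma real_traceI:
  "\<lbrakk>i \<in> idx Y; p \<in> cdom Y i; p \<in> E; chart Y i p = of_real x\<rbrakk> \<Longrightarrow> x \<in> real_trace Y i E"
  unfolding real_trace_def by force

lemma real_trace_mem_iff:
  assumes "i \<in> idx Y" "p \<in> cdom Y i" "chart Y i p = of_real x"
  shows "x \<in> real_trace Y i E \<longleftrightarrow> p \<in> E"
  using assms by (metis inv_chart_chart real_traceE real_traceI)

lemma real_trace_mono: "E \<subseteq> E' \<Longrightarrow> real_trace Y i E \<subseteq> real_trace Y i E'"
  by (auto simp: real_trace_def)

lemma open_real_trace_cdom:
  assumes "i \<in> idx Y" "j \<in> idx Y"
  shows "open (real_trace Y i (cdom Y j))"
proof -
  obtain W where W: "open W" "overlap Y j i = half_plane \<inter> W" using overlap_open assms by metis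
  have "real_trace Y i (cdom Y j) = of_real -` W"
    using W(2) by (auto simp: real_trace_def overlap_def Int_commute half_plane_def)
  moreover have "open (of_real -` W :: real set)"
    using W(1) by (intro open_vimage continuous_intros)
  ultimately show ?thesis by simp
qed

section \<open>The spin cocycle\<close>

lemma cocycle:
  assumes "i \<in> idx Y" "j \<in> idx Y" "k \<in> idx Y" "p \<in> cdom Y i" "p \<in> cdom Y j" "p \<in> cdom Y k"
  shows "s i j p * s j k p = s i k p"
  using spin assms by (simp add: spin_structure_def)

text \<open>Moving straight up from a point never leaves the half plane. This makes derivatives
  within chart images unique, at boundary points too.\<close>

lemma chart_islimpt:
  assumes i: "i \<in> idx Y" "p \<in> cdom Y i"
  shows "chart Y i p islimpt overlap Y i i"
proof -
  obtain W where W: "open W" "overlap Y i i = half_plane \<inter> W" using overlap_open i by metis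
  let ?w = "chart Y i p"
  have w: "?w \<in> overlap Y i i" using i by (auto simp: overlap_def)
  then obtain d where d: "d > 0" "ball ?w d \<subseteq> W" using W by (metis IntD2 openE)
  show ?thesis unfolding islimpt_approachable
  proof (intro allI impI)
    fix e :: real assume "e > 0"
    define t where "t = min e d / 2"
    have t: "t > 0" "t < e" "t < d" using \<open>e > 0\<close> d(1) by (auto simp: t_def)
    then have "?w + \<i> * t \<in> ball ?w d" by (simp add: dist_norm norm_mult)
    then have "?w + \<i> * t \<in> overlap Y i i"
      using d(2) w t unfolding W(2) by (auto simp: half_plane_def)
    then show "\<exists>x'\<in>overlap Y i i. x' \<noteq> ?w \<and> dist x' ?w < e"
      using t by (intro bexI[of _ "?w + \<i> * t"]) (auto simp: dist_norm norm_mult)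
  qed
qed

text \<open>The multiplicative law alone admits the zero cocycle. The derivative condition excludes
  it: the transition from a chart to itself is the identity, so \<open>(s i i p)\<^sup>2\<close> is
  1, and \<open>s i j p\<close> is a factor of \<open>s i i p\<close>.\<close>

lemma cocycle_nonzero:
  assumes "i \<in> idx Y" "j \<in> idx Y" "p \<in> cdom Y i" "p \<in> cdom Y j"
  shows "s i j p \<noteq> 0"
proof -
  let ?w = "chart Y i p"
  have w: "?w \<in> overlap Y i i" using assms by (auto simp: overlap_def)
  have id: "transition Y i i z = z" if "z \<in> overlap Y i i" for z
    using that assms by (auto simp: overlap_def transition_chart)
  have "(transition Y i i has_field_derivative (s i i p)\<^sup>2) (at ?w within overlap Y i i)"
    using spin assms by (simp add: spin_structure_def)
  then have "((\<lambda>y. (transition Y i i y - transition Y i i ?w) / (y - ?w)) \<longlongrightarrow> (s i i p)\<^sup>2)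
      (at ?w within overlap Y i i)" by (simp add: has_field_derivative_iff)
  moreover have "((\<lambda>y. (transition Y i i y - transition Y i i ?w) / (y - ?w)) \<longlongrightarrow> 1)
      (at ?w within overlap Y i i)"
    by (rule Lim_transform_eventually[OF tendsto_const]) (auto simp: eventually_at_filter id w)
  moreover have "at ?w within overlap Y i i \<noteq> bot"
    using chart_islimpt assms by (simp add: trivial_limit_within)
  ultimately have "(s i i p)\<^sup>2 = 1" using tendsto_unique by blast
  then show ?thesis using cocycle[of i j i p] assms by auto
qed

section \<open>Integration over the boundary\<close>

abbreviation "cover_size \<equiv> length (bd_cover Y)"
abbreviation "cov n \<equiv> bd_cover Y ! n"
abbreviation "piece n \<equiv> lebesgue_on (real_trace Y (cov n) (bd_piece Y n))"

text \<open>On the piece with number \<open>n\<close> all integrals see only the coefficient in the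
  cover chart of that number, read off in its real coordinate.\<close>

definition coord :: "('i \<Rightarrow> 'a \<Rightarrow> 'v) \<Rightarrow> nat \<Rightarrow> real \<Rightarrow> 'v" where
  "coord h n x = h (cov n) (inv_chart Y (cov n) (of_real x))"

text \<open>Compactness gives a finite subcover, so the \<open>SOME\<close> in the definition has a
  witness.\<close>

lemma bd_cover: "set (bd_cover Y) \<subseteq> idx Y" "bd Y \<subseteq> (\<Union>i\<in>set (bd_cover Y). cdom Y i)"
proof -
  have un: "(\<Union>i\<in>idx Y. cdom Y i) = topspace (surf_top Y)" and "compact_space (surf_top Y)"
    using surface by (simp_all add: compact_connected_bordered_riemann_surface_def)
  then obtain \<F> where \<F>: "finite \<F>" "\<F> \<subseteq> cdom Y ` idx Y" "\<Union>\<F> = topspace (surf_top Y)"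
    unfolding compact_space using openin_cdom by (metis (mono_tags, lifting) imageE)
  then obtain I where I: "finite I" "I \<subseteq> idx Y" "\<F> = cdom Y ` I" using finite_subset_image by metis
  obtain l where "set l = I" using I finite_list by blast
  then have "set l \<subseteq> idx Y \<and> bd Y \<subseteq> (\<Union>i\<in>set l. cdom Y i)"
    using I \<F> un by (auto simp: bd_def)
  then have "set (bd_cover Y) \<subseteq> idx Y \<and> bd Y \<subseteq> (\<Union>i\<in>set (bd_cover Y). cdom Y i)"
    unfolding bd_cover_def by (rule someI)
  then show "set (bd_cover Y) \<subseteq> idx Y" "bd Y \<subseteq> (\<Union>i\<in>set (bd_cover Y). cdom Y i)" by auto
qed

lemma cov_idx: "n < cover_size \<Longrightarrow> cov n \<in> idx Y"
  using bd_cover(1) by auto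

lemma bd_in_piece:
  assumes "p \<in> bd Y"
  obtains n where "n < cover_size" "p \<in> bd_piece Y n" "p \<in> cdom Y (cov n)"
proof -
  have ex: "\<exists>n. n < cover_size \<and> p \<in> cdom Y (cov n)"
    using bd_cover(2) assms by (metis UN_E in_set_conv_nth subsetD)
  define n where "n = (LEAST n. n < cover_size \<and> p \<in> cdom Y (cov n))"
  have n: "n < cover_size \<and> p \<in> cdom Y (cov n)" unfolding n_def using ex by (rule LeastI_ex)
  then have "p \<notin> cdom Y (cov m)" if "m < n" for m
    using not_less_Least[of m "\<lambda>n. n < cover_size \<and> p \<in> cdom Y (cov n)"] that
    unfolding n_def[symmetric] by auto
  then show ?thesis using n assms by (intro that[of n]) (auto simp: bd_piece_def)
qed

text \<open>A point with a real chart value is automatically a boundary point, so in coordinates a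
  piece is an open set minus finitely many open sets.\<close>

lemma piece_sets:
  assumes "n < cover_size"
  shows "real_trace Y (cov n) (bd_piece Y n) \<in> sets lebesgue"
proof -
  let ?T = "real_trace Y (cov n)"
  have "?T (bd_piece Y n) = ?T (cdom Y (cov n)) - (\<Union>m<n. ?T (cdom Y (cov m)))"
  proof (intro set_eqI)
    fix x
    note i = cov_idx[OF assms]
    show "x \<in> ?T (bd_piece Y n) \<longleftrightarrow> x \<in> ?T (cdom Y (cov n)) - (\<Union>m<n. ?T (cdom Y (cov m)))"
    proof (cases "x \<in> ?T UNIV")
      case True
      obtain p where p: "p \<in> cdom Y (cov n)" "p \<in> bd Y" "chart Y (cov n) p = of_real x"
        using real_traceE[OF i True] by metis
      show ?thesis using p by (simp add: real_trace_mem_iff[OF i p(1,3)] bd_piece_def)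
    next
      case False
      then show ?thesis using real_trace_mono[OF subset_UNIV] by blast
    qed
  qed
  moreover have "open (?T (cdom Y (cov m)))" if "m \<le> n" for m
    using that assms by (intro open_real_trace_cdom cov_idx) auto
  ultimately show ?thesis by (auto intro!: sets.Diff sets.finite_UN simp: less_imp_le)
qed

lemma piece_subset_bd: "real_trace Y (cov n) (bd_piece Y n) \<subseteq> real_trace Y (cov n) (bd Y)"
  by (intro real_trace_mono) (auto simp: bd_piece_def)

lemma inv_chart_piece_bd:
  assumes "n < cover_size" "x \<in> space (piece n)"
  shows "inv_chart Y (cov n) (of_real x) \<in> bd Y"
proof -
  have "x \<in> real_trace Y (cov n) (bd_piece Y n)" using assms(2) by simp
  then show ?thesis by (metis real_traceE[OF cov_idx[OF assms(1)]])
qed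

lemma bd_integral_coord: "bd_integral Y \<rho> = (\<Sum>n<cover_size. \<integral>x. coord \<rho> n x \<partial>piece n)"
  unfolding bd_integral_def Let_def set_lebesgue_integral_def coord_def
  by (intro sum.cong refl integral_restrict_space[symmetric]) (simp add: piece_sets)

lemma bd_integrable_coord: "bd_integrable Y \<rho> \<longleftrightarrow> (\<forall>n<cover_size. integrable (piece n) (coord \<rho> n))"
  unfolding bd_integrable_def Let_def set_integrable_def coord_def
  by (intro all_cong1 imp_cong refl integrable_restrict_space[symmetric]) (simp add: piece_sets)

lemma coord_measurable:
  assumes "bd_measurable Y h" "n < cover_size"
  shows "coord h n \<in> borel_measurable (piece n)"
  using assms cov_idx unfolding bd_measurable_def coord_def[abs_def]
  by (intro measurable_restrict_mono[OF _ piece_subset_bd]) auto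

lemma L2_bd_iff:
  "\<psi> \<in> L2_bd Y s \<longleftrightarrow> section2_over Y s (bd Y) \<psi> \<and> bd_measurable Y \<psi> \<and>
     (\<forall>n<cover_size. integrable (piece n) (\<lambda>x. (norm (coord \<psi> n x))\<^sup>2))"
proof -
  have "coord (\<lambda>i p. complex_of_real ((norm (\<psi> i p))\<^sup>2)) n = (\<lambda>x. complex_of_real ((norm (coord \<psi> n x))\<^sup>2))"
    for n by (simp add: coord_def fun_eq_iff)
  then show ?thesis
    unfolding L2_bd_def bd_integrable_coord by (simp only: complex_of_real_integrable_eq mem_Collect_eq)
qed

end

section \<open>Pointwise estimates for vectors and matrices\<close>

lemma norm_add_square_le: "(norm (v + w))\<^sup>2 \<le> 2 * (norm v)\<^sup>2 + 2 * (norm w :: real)\<^sup>2"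
  for v w :: "'b::real_normed_vector"
proof -
  have "(norm (v + w))\<^sup>2 \<le> (norm v + norm w)\<^sup>2"
    by (intro power_mono norm_triangle_ineq) simp
  also have "\<dots> \<le> 2 * (norm v)\<^sup>2 + 2 * (norm w)\<^sup>2"
    using zero_le_power2[of "norm v - norm w"] by (simp add: power2_eq_square algebra_simps)
  finally show ?thesis .
qed

lemma abs_inner_le_squares: "\<bar>v \<bullet> w\<bar> \<le> (norm v)\<^sup>2 + (norm w)\<^sup>2"
  for v w :: "'b::real_inner"
proof -
  have "0 \<le> (norm v - norm w)\<^sup>2" "0 \<le> norm v * norm w" by simp_all
  then have "norm v * norm w \<le> (norm v)\<^sup>2 + (norm w)\<^sup>2"
    unfolding power2_diff by linarith
  then show ?thesis using Cauchy_Schwarz_ineq2[of v w] by linarith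
qed

text \<open>The crude constant 4 counts the entries of the matrix.\<close>

lemma norm_matrix_vector_mult_le:
  fixes m :: "complex ^ 2 ^ 2"
  assumes "\<And>k l. cmod (m $ k $ l) \<le> B"
  shows "norm (m *v v) \<le> 4 * B * norm v"
proof -
  have "norm (m *v v) \<le> (\<Sum>k\<in>UNIV. cmod ((m *v v) $ k))"
    unfolding norm_vec_def by (rule L2_set_le_sum) simp
  also have "\<dots> \<le> (\<Sum>k\<in>(UNIV::2 set). \<Sum>l\<in>(UNIV::2 set). B * norm v)"
  proof (rule sum_mono)
    fix k :: 2
    have "cmod ((m *v v) $ k) \<le> (\<Sum>l\<in>UNIV. cmod (m $ k $ l * v $ l))"
      by (simp add: matrix_vector_mult_def norm_sum)
    also have "\<dots> \<le> (\<Sum>l\<in>(UNIV::2 set). B * norm v)"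
      unfolding norm_mult
      by (intro sum_mono mult_mono assms Finite_Cartesian_Product.norm_nth_le norm_ge_zero order_trans[OF norm_ge_zero assms])
    finally show "cmod ((m *v v) $ k) \<le> (\<Sum>l\<in>(UNIV::2 set). B * norm v)" .
  qed
  also have "\<dots> = 4 * B * norm v" by simp
  finally show ?thesis .
qed

lemma Re_hermitian_inner: "Re (\<Sum>l\<in>UNIV. v $ l * cnj (w $ l)) = v \<bullet> w" for v w :: "complex ^ 2"
  by (simp add: inner_vec_def inner_complex_def sum_2)

lemma matrix_vector_mult_scaleC: "m *v (c *s v) = c *s (m *v v)"
  for m :: "complex ^ 2 ^ 2" and v :: "complex ^ 2"
  by (simp add: vec_eq_iff matrix_vector_mult_def sum_distrib_left mult_ac)

context bordered_spin_surface
begin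

section \<open>Square integrable sections and their inner product\<close>

lemma section2_overD:
  "\<lbrakk>section2_over Y s W \<psi>; i \<in> idx Y; j \<in> idx Y; p \<in> cdom Y i; p \<in> cdom Y j; p \<in> W\<rbrakk>
    \<Longrightarrow> \<psi> j p = s i j p *s \<psi> i p"
  unfolding section2_over_def section_over_def vec_eq_iff vector_smult_component
  by (metis Int_iff mult.commute)

lemma section2_overI:
  "(\<And>i j p. \<lbrakk>i \<in> idx Y; j \<in> idx Y; p \<in> cdom Y i; p \<in> cdom Y j; p \<in> W\<rbrakk>
    \<Longrightarrow> \<psi> j p = s i j p *s \<psi> i p) \<Longrightarrow> section2_over Y s W \<psi>"
  unfolding section2_over_def section_over_def
  by (metis Int_iff mult.commute vector_smult_component)

lemma section2_over_add:
  assumes "section2_over Y s W \<psi>" "section2_over Y s W \<phi>"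
  shows "section2_over Y s W (\<psi> + \<phi>)"
proof (rule section2_overI)
  fix i j p
  assume "i \<in> idx Y" "j \<in> idx Y" "p \<in> cdom Y i" "p \<in> cdom Y j" "p \<in> W"
  with assms have "\<psi> j p = s i j p *s \<psi> i p" "\<phi> j p = s i j p *s \<phi> i p"
    by (blast intro: section2_overD)+
  then show "(\<psi> + \<phi>) j p = s i j p *s (\<psi> + \<phi>) i p"
    by (simp add: vec_eq_iff distrib_left)
qed

lemma section2_over_scaleR:
  assumes "section2_over Y s W \<psi>"
  shows "section2_over Y s W (r *\<^sub>R \<psi>)"
proof (rule section2_overI)
  fix i j p
  assume "i \<in> idx Y" "j \<in> idx Y" "p \<in> cdom Y i" "p \<in> cdom Y j" "p \<in> W"
  with assms have "\<psi> j p = s i j p *s \<psi> i p"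
    by (blast intro: section2_overD)
  then show "(r *\<^sub>R \<psi>) j p = s i j p *s (r *\<^sub>R \<psi>) i p"
    by (simp add: vec_eq_iff)
qed

lemma section2_over_mult_op:
  assumes "section2_over Y s W \<psi>"
  shows "section2_over Y s W (mult_op G \<psi>)"
proof (rule section2_overI)
  fix i j p
  assume "i \<in> idx Y" "j \<in> idx Y" "p \<in> cdom Y i" "p \<in> cdom Y j" "p \<in> W"
  with assms have "\<psi> j p = s i j p *s \<psi> i p"
    by (blast intro: section2_overD)
  then show "mult_op G \<psi> j p = s i j p *s mult_op G \<psi> i p"
    by (simp add: mult_op_def matrix_vector_mult_scaleC)
qed

lemma coord_add: "coord (\<psi> + \<phi>) n x = coord \<psi> n x + coord \<phi> n x"
  and coord_diff: "coord (\<psi> - \<phi>) n x = coord \<psi> n x - coord \<phi> n x"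
  and coord_scaleR: "coord (r *\<^sub>R \<psi>) n x = r *\<^sub>R coord \<psi> n x"
  by (simp_all add: coord_def fun_diff_def)

lemma bd_measurable_add:
  "\<lbrakk>bd_measurable Y \<psi>; bd_measurable Y \<phi>\<rbrakk> \<Longrightarrow> bd_measurable Y (\<psi> + \<phi>)"
  for \<psi> \<phi> :: "'i \<Rightarrow> 'a \<Rightarrow> complex ^ 2"
  by (auto simp: bd_measurable_def intro!: borel_measurable_add)

lemma bd_measurable_scaleR: "bd_measurable Y \<psi> \<Longrightarrow> bd_measurable Y (r *\<^sub>R \<psi>)"
  for \<psi> :: "'i \<Rightarrow> 'a \<Rightarrow> complex ^ 2"
  by (auto simp: bd_measurable_def intro!: borel_measurable_scaleR)

lemma bd_measurable_mult_op:
  assumes "bd_measurable Y (\<lambda>i. G)" "bd_measurable Y \<psi>"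
  shows "bd_measurable Y (mult_op G \<psi>)"
proof -
  have "continuous_on UNIV (\<lambda>x. fst x *v snd x :: complex ^ 2)"
    unfolding matrix_vector_mult_def by (intro continuous_intros)
  then show ?thesis using assms
    unfolding bd_measurable_def mult_op_def
    by (intro ballI borel_measurable_continuous_Pair[where H = "(*v)"]) auto
qed

lemma L2_coord_measurable:
  "\<lbrakk>\<psi> \<in> L2_bd Y s; n < cover_size\<rbrakk> \<Longrightarrow> coord \<psi> n \<in> borel_measurable (piece n)"
  by (simp add: L2_bd_iff coord_measurable)

lemma L2_integrable:
  "\<lbrakk>\<psi> \<in> L2_bd Y s; n < cover_size\<rbrakk> \<Longrightarrow> integrable (piece n) (\<lambda>x. (norm (coord \<psi> n x))\<^sup>2)"
  by (simp add: L2_bd_iff)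

lemma L2_add:
  assumes "\<psi> \<in> L2_bd Y s" "\<phi> \<in> L2_bd Y s" shows "\<psi> + \<phi> \<in> L2_bd Y s"
proof -
  have "integrable (piece n) (\<lambda>x. (norm (coord (\<psi> + \<phi>) n x))\<^sup>2)" if n: "n < cover_size" for n
  proof (rule Bochner_Integration.integrable_bound)
    show "integrable (piece n) (\<lambda>x. 2 * (norm (coord \<psi> n x))\<^sup>2 + 2 * (norm (coord \<phi> n x))\<^sup>2)"
      using assms n by (auto simp: L2_bd_iff)
    have "coord (\<psi> + \<phi>) n \<in> borel_measurable (piece n)"
      using assms n by (intro coord_measurable bd_measurable_add) (auto simp: L2_bd_iff)
    then show "(\<lambda>x. (norm (coord (\<psi> + \<phi>) n x))\<^sup>2) \<in> borel_measurable (piece n)" by measurable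
  qed (use norm_add_square_le in \<open>auto simp: coord_add\<close>)
  then show ?thesis using assms by (simp add: L2_bd_iff section2_over_add bd_measurable_add)
qed

lemma L2_scaleR: "\<psi> \<in> L2_bd Y s \<Longrightarrow> r *\<^sub>R \<psi> \<in> L2_bd Y s"
  by (simp add: L2_bd_iff section2_over_scaleR bd_measurable_scaleR coord_scaleR power_mult_distrib)

lemma L2_zero: "0 \<in> L2_bd Y s"
  by (simp add: L2_bd_iff section2_over_def section_over_def bd_measurable_def coord_def)

lemma subspace_L2: "subspace (L2_bd Y s)"
  by (intro subspaceI L2_zero L2_add L2_scaleR)

definition ip :: "('i \<Rightarrow> 'a \<Rightarrow> complex ^ 2) \<Rightarrow> ('i \<Rightarrow> 'a \<Rightarrow> complex ^ 2) \<Rightarrow> real" where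
  "ip \<psi> \<phi> = Re (inner_bd Y \<psi> \<phi>)"

lemma integrable_inner:
  assumes "\<psi> \<in> L2_bd Y s" "\<phi> \<in> L2_bd Y s" "n < cover_size"
  shows "integrable (piece n) (\<lambda>x. coord \<psi> n x \<bullet> coord \<phi> n x)"
proof (rule Bochner_Integration.integrable_bound)
  show "integrable (piece n) (\<lambda>x. (norm (coord \<psi> n x))\<^sup>2 + (norm (coord \<phi> n x))\<^sup>2)"
    by (intro Bochner_Integration.integrable_add L2_integrable assms)
  have "coord \<psi> n \<in> borel_measurable (piece n)" "coord \<phi> n \<in> borel_measurable (piece n)"
    by (intro L2_coord_measurable assms)+
  then show "(\<lambda>x. coord \<psi> n x \<bullet> coord \<phi> n x) \<in> borel_measurable (piece n)"
    by (rule borel_measurable_inner)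
  show "AE x in piece n. norm (coord \<psi> n x \<bullet> coord \<phi> n x)
      \<le> norm ((norm (coord \<psi> n x))\<^sup>2 + (norm (coord \<phi> n x))\<^sup>2)"
    by (intro AE_I2) (simp add: abs_inner_le_squares)
qed

lemma mult_op_diff: "mult_op G (\<psi> - \<phi>) = mult_op G \<psi> - mult_op G \<phi>"
  by (simp add: mult_op_def fun_eq_iff fun_diff_def matrix_vector_mult_diff_distrib)

lemma bd_measurable_const: "bd_measurable Y (\<lambda>i p. m)"
  by (simp add: bd_measurable_def)

text \<open>The constant is the square of the pointwise bound \<open>4 * B\<close>. Bounding
  \<open>G\<close> on the boundary is enough because every piece lies in it.\<close>

lemma L2_mult_op:
  fixes G :: "'a \<Rightarrow> complex ^ 2 ^ 2"
  assumes \<psi>: "\<psi> \<in> L2_bd Y s" and G: "bd_measurable Y (\<lambda>i. G)"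
    and B: "\<And>p k l. p \<in> bd Y \<Longrightarrow> cmod (G p $ k $ l) \<le> B"
  shows "mult_op G \<psi> \<in> L2_bd Y s"
    and "n < cover_size \<Longrightarrow> (\<integral>x. (norm (coord (mult_op G \<psi>) n x))\<^sup>2 \<partial>piece n)
      \<le> 16 * B\<^sup>2 * (\<integral>x. (norm (coord \<psi> n x))\<^sup>2 \<partial>piece n)"
proof -
  have le: "(norm (coord (mult_op G \<psi>) n x))\<^sup>2 \<le> 16 * B\<^sup>2 * (norm (coord \<psi> n x))\<^sup>2"
    if n: "n < cover_size" and x: "x \<in> space (piece n)" for n x
  proof -
    have "norm (coord (mult_op G \<psi>) n x) \<le> 4 * B * norm (coord \<psi> n x)"
      unfolding coord_def mult_op_def
      by (intro norm_matrix_vector_mult_le B inv_chart_piece_bd[OF that])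
    from power_mono[OF this, of 2] show ?thesis by (simp add: power_mult_distrib)
  qed
  have int: "integrable (piece n) (\<lambda>x. 16 * B\<^sup>2 * (norm (coord \<psi> n x))\<^sup>2)" if "n < cover_size" for n
    using that \<psi> by (auto simp: L2_bd_iff)
  have int': "integrable (piece n) (\<lambda>x. (norm (coord (mult_op G \<psi>) n x))\<^sup>2)"
    if n: "n < cover_size" for n
  proof (rule Bochner_Integration.integrable_bound[OF int[OF n]])
    have "coord (mult_op G \<psi>) n \<in> borel_measurable (piece n)"
      using assms n by (intro coord_measurable bd_measurable_mult_op) (auto simp: L2_bd_iff)
    then show "(\<lambda>x. (norm (coord (mult_op G \<psi>) n x))\<^sup>2) \<in> borel_measurable (piece n)" by measurable
    show "AE x in piece n. norm ((norm (coord (mult_op G \<psi>) n x))\<^sup>2)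
        \<le> norm (16 * B\<^sup>2 * (norm (coord \<psi> n x))\<^sup>2)"
      using le[OF n] by (intro AE_I2) (simp add: abs_mult)
  qed
  then show "mult_op G \<psi> \<in> L2_bd Y s"
    using \<psi> G by (simp add: L2_bd_iff section2_over_mult_op bd_measurable_mult_op)
  show "(\<integral>x. (norm (coord (mult_op G \<psi>) n x))\<^sup>2 \<partial>piece n)
      \<le> 16 * B\<^sup>2 * (\<integral>x. (norm (coord \<psi> n x))\<^sup>2 \<partial>piece n)" if n: "n < cover_size"
    using integral_mono[OF int'[OF n] int[OF n] le[OF n]] by simp
qed

lemma integrable_hermitian:
  fixes \<psi> \<phi> :: "'i \<Rightarrow> 'a \<Rightarrow> complex ^ 2"
  assumes \<psi>: "\<psi> \<in> L2_bd Y s" and \<phi>: "\<phi> \<in> L2_bd Y s" and n: "n < cover_size"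
  shows "integrable (piece n) (\<lambda>x. \<Sum>l\<in>UNIV. coord \<psi> n x $ l * cnj (coord \<phi> n x $ l))"
proof (rule Bochner_Integration.integrable_sum, rule Bochner_Integration.integrable_bound)
  fix l :: 2
  show "integrable (piece n) (\<lambda>x. (norm (coord \<psi> n x))\<^sup>2 + (norm (coord \<phi> n x))\<^sup>2)"
    by (intro Bochner_Integration.integrable_add L2_integrable assms)
  have meas: "(\<lambda>x. coord h n x $ l) \<in> borel_measurable (piece n)" if "h \<in> L2_bd Y s"
    for h :: "'i \<Rightarrow> 'a \<Rightarrow> complex ^ 2"
  proof -
    have "coord h n \<in> borel_measurable (piece n)"
      using that n by (rule L2_coord_measurable)
    then show ?thesis
      by (rule measurable_compose[where g = "\<lambda>v. v $ l"])
        (intro borel_measurable_continuous_onI continuous_intros)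
  qed
  show "(\<lambda>x. coord \<psi> n x $ l * cnj (coord \<phi> n x $ l)) \<in> borel_measurable (piece n)"
    using meas[OF \<psi>] meas[OF \<phi>]
    by (intro borel_measurable_times borel_measurable_continuous_on[where f = cnj]
      continuous_on_cnj continuous_on_id)
  have "cmod (v $ l * cnj (w $ l)) \<le> (norm v)\<^sup>2 + (norm w)\<^sup>2" for v w :: "complex ^ 2"
  proof -
    have "0 \<le> (norm v - norm w)\<^sup>2" "0 \<le> norm v * norm w" by simp_all
    moreover have "cmod (v $ l) * cmod (w $ l) \<le> norm v * norm w"
      by (intro mult_mono Finite_Cartesian_Product.norm_nth_le) auto
    ultimately show ?thesis unfolding norm_mult power2_diff complex_mod_cnj by linarith
  qed
  then show "AE x in piece n. norm (coord \<psi> n x $ l * cnj (coord \<phi> n x $ l))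
      \<le> norm ((norm (coord \<psi> n x))\<^sup>2 + (norm (coord \<phi> n x))\<^sup>2)"
    by (intro AE_I2) simp
qed

lemma ip_eq:
  assumes "\<psi> \<in> L2_bd Y s" "\<phi> \<in> L2_bd Y s"
  shows "ip \<psi> \<phi> = (\<Sum>n<cover_size. \<integral>x. coord \<psi> n x \<bullet> coord \<phi> n x \<partial>piece n)"
proof -
  have "coord (\<lambda>i p. \<Sum>l\<in>UNIV. \<psi> i p $ l * cnj (\<phi> i p $ l)) n =
      (\<lambda>x. \<Sum>l\<in>UNIV. coord \<psi> n x $ l * cnj (coord \<phi> n x $ l))" for n
    by (simp add: coord_def fun_eq_iff)
  then show ?thesis
    unfolding ip_def inner_bd_def bd_integral_coord Re_sum
    using integrable_hermitian[OF assms]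
    by (intro sum.cong refl) (simp add: integral_Re[symmetric] Re_hermitian_inner del: Re_sum)
qed

lemma ip_self_eq:
  assumes "\<psi> \<in> L2_bd Y s"
  shows "ip \<psi> \<psi> = (\<Sum>n<cover_size. \<integral>x. (norm (coord \<psi> n x))\<^sup>2 \<partial>piece n)"
  by (simp only: ip_eq[OF assms assms] power2_norm_eq_inner)

sublocale semi_inner "L2_bd Y s" ip
proof
  fix x y z :: "'i \<Rightarrow> 'a \<Rightarrow> complex ^ 2" and r :: real
  assume x: "x \<in> L2_bd Y s"
  show "0 \<le> ip x x" using x by (simp add: ip_eq sum_nonneg)
  assume z: "z \<in> L2_bd Y s"
  show "ip (r *\<^sub>R x) z = r * ip x z"
    using x z by (simp add: ip_eq L2_scaleR coord_scaleR sum_distrib_left)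
  show "ip x z = ip z x" using x z by (simp add: ip_eq inner_commute)
  assume y: "y \<in> L2_bd Y s"
  show "ip (x + y) z = ip x z + ip y z"
    using x y z integrable_inner[OF x z] integrable_inner[OF y z]
    by (simp add: ip_eq L2_add coord_add inner_add_left sum.distrib)
qed (rule subspace_L2)

lemma ip_mult_op_le:
  fixes G :: "'a \<Rightarrow> complex ^ 2 ^ 2"
  assumes \<psi>: "\<psi> \<in> L2_bd Y s" and G: "bd_measurable Y (\<lambda>i. G)"
    and B: "\<And>p k l. p \<in> bd Y \<Longrightarrow> cmod (G p $ k $ l) \<le> B"
  shows "ip (mult_op G \<psi>) (mult_op G \<psi>) \<le> 16 * B\<^sup>2 * ip \<psi> \<psi>"
proof -
  have "mult_op G \<psi> \<in> L2_bd Y s" by (rule L2_mult_op(1)[OF assms])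
  then show ?thesis
    unfolding ip_self_eq[OF \<psi>] sum_distrib_left
    using L2_mult_op(2)[OF assms] by (auto simp: ip_self_eq intro: sum_mono)
qed

text \<open>The two integrands agree pointwise, so no integrability is asked for.\<close>

lemma ip_mult_op_adjoint:
  "ip (mult_op (\<lambda>p. hermitian_adjoint (G p)) \<psi>) \<phi> = ip \<psi> (mult_op G \<phi>)"
proof -
  have "(\<Sum>l\<in>UNIV. (hermitian_adjoint m *v v) $ l * cnj (w $ l)) =
      (\<Sum>l\<in>UNIV. v $ l * cnj ((m *v w) $ l))" for m :: "complex ^ 2 ^ 2" and v w
    by (simp add: matrix_vector_mult_def hermitian_adjoint_def sum_2 algebra_simps)
  then show ?thesis by (simp add: ip_def inner_bd_def mult_op_def)
qed

text \<open>The form is conjugate linear in its second argument, so multiplying that argument by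
  \<open>\<i>\<close> makes the imaginary part appear as a real part.\<close>

lemma inner_bd_eq_0_iff:
  "inner_bd Y \<psi> \<phi> = 0 \<longleftrightarrow> ip \<psi> \<phi> = 0 \<and> ip \<psi> (mult_op (\<lambda>p. mat \<i>) \<phi>) = 0"
proof -
  have mat: "mat \<i> *v v = \<i> *s v" for v :: "complex ^ 2"
    by (simp add: vec_eq_iff matrix_vector_mult_def mat_def if_distrib if_distribR cong: if_cong)
  have "inner_bd Y \<psi> (mult_op (\<lambda>p. mat \<i>) \<phi>) = - \<i> * inner_bd Y \<psi> \<phi>"
  proof -
    have "coord (\<lambda>i p. \<Sum>l\<in>UNIV. \<psi> i p $ l * cnj (mult_op (\<lambda>p. mat \<i>) \<phi> i p $ l)) n =
        (\<lambda>x. - \<i> * coord (\<lambda>i p. \<Sum>l\<in>UNIV. \<psi> i p $ l * cnj (\<phi> i p $ l)) n x)" for n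
      by (simp add: coord_def fun_eq_iff mult_op_def mat sum_distrib_left sum_negf algebra_simps)
    then show ?thesis
      unfolding inner_bd_def bd_integral_coord by (simp only: integral_mult_right_zero sum_distrib_left)
  qed
  then show ?thesis by (simp add: ip_def complex_eq_iff)
qed

lemma norm_bd_eq: "norm_bd Y \<psi> = sqrt (ip \<psi> \<psi>)"
  by (simp add: norm_bd_def ip_def)

lemma L2_complete:
  assumes L2: "\<And>k. h k \<in> L2_bd Y s"
    and fast: "\<And>m k. k \<le> m \<Longrightarrow> ip (h m - h k) (h m - h k) \<le> (1/4) ^ k"
  shows "\<exists>\<xi>\<in>L2_bd Y s. (\<lambda>k. ip (h k - \<xi>) (h k - \<xi>)) \<longlonglongrightarrow> 0"
proof -
  \<comment> \<open>The default 0 respects the cocycle: \<open>s i j p\<close> is not zero, so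
    whether the sequence converges at \<open>p\<close> does not depend on the chart.\<close>
  define \<xi> where "\<xi> = (\<lambda>i p. if convergent (\<lambda>k. h k i p) then lim (\<lambda>k. h k i p) else 0)"
  have diff: "h m - h k \<in> L2_bd Y s" for m k by (intro V_intros L2)
  have sec: "section2_over Y s (bd Y) \<xi>"
  proof (rule section2_overI)
    fix i j p
    assume ij: "i \<in> idx Y" "j \<in> idx Y" and p: "p \<in> cdom Y i" "p \<in> cdom Y j" "p \<in> bd Y"
    have nz: "s i j p \<noteq> 0" by (rule cocycle_nonzero[OF ij p(1,2)])
    have hj: "h k j p = s i j p *s h k i p" for k
      using L2[of k] ij p by (auto simp: L2_bd_iff intro: section2_overD)
    have lim: "(\<lambda>k. c *s v k) \<longlonglongrightarrow> c *s w" if "v \<longlonglongrightarrow> w" for c w and v :: "nat \<Rightarrow> complex ^ 2"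
      using that by (intro vec_tendstoI) (auto intro!: tendsto_intros)
    show "\<xi> j p = s i j p *s \<xi> i p"
    proof (cases "convergent (\<lambda>k. h k i p)")
      case True
      then have "(\<lambda>k. h k i p) \<longlonglongrightarrow> \<xi> i p" by (simp add: \<xi>_def convergent_LIMSEQ_iff)
      from lim[OF this, of "s i j p"] have "(\<lambda>k. h k j p) \<longlonglongrightarrow> s i j p *s \<xi> i p" by (simp add: hj)
      then show ?thesis unfolding \<xi>_def by (simp add: convergentI limI)
    next
      case False
      have "\<not> convergent (\<lambda>k. h k j p)"
      proof
        assume "convergent (\<lambda>k. h k j p)"
        then obtain w where "(\<lambda>k. h k j p) \<longlonglongrightarrow> w" by (auto simp: convergent_def)
        from lim[OF this, of "1 / s i j p"] have "(\<lambda>k. h k i p) \<longlonglongrightarrow> (1 / s i j p) *s w"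
          using nz by (simp add: hj)
        then show False using False by (auto simp: convergent_def)
      qed
      then show ?thesis using False by (simp add: \<xi>_def)
    qed
  qed
  have meas: "bd_measurable Y \<xi>"
    unfolding bd_measurable_def
  proof
    fix i assume i: "i \<in> idx Y"
    let ?M = "lebesgue_on (real_trace Y i (bd Y))"
    have [measurable]: "(\<lambda>x. h k i (inv_chart Y i (of_real x))) \<in> borel_measurable ?M" for k
      using L2[of k] i by (simp add: L2_bd_iff bd_measurable_def)
    show "(\<lambda>x. \<xi> i (inv_chart Y i (of_real x))) \<in> borel_measurable ?M"
      \<comment> \<open>The Cauchy criterion is a countable condition, which makes the set of
        convergence measurable.\<close>
      unfolding \<xi>_def Cauchy_convergent_iff[symmetric] by measurable
  qed
  have step: "integrable (piece n) (\<lambda>x. (norm (coord (\<xi> - h k) n x))\<^sup>2) \<and>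
      (\<integral>x. (norm (coord (\<xi> - h k) n x))\<^sup>2 \<partial>piece n) \<le> (1/4) ^ k" if n: "n < cover_size" for n k
  proof -
    have hmeas: "coord (h k) n \<in> borel_measurable (piece n)" for k
      using L2 n by (rule L2_coord_measurable)
    have bound: "(\<integral>\<^sup>+ x. ennreal ((norm (coord (h m) n x - coord (h k) n x))\<^sup>2) \<partial>piece n)
        \<le> ennreal ((1/4) ^ k)" if "k \<le> m" for m k
    proof -
      have int: "integrable (piece n) (\<lambda>x. (norm (coord (h m - h k) n x))\<^sup>2)"
        using diff n by (auto simp: L2_bd_iff)
      have "(\<integral>x. (norm (coord (h m - h k) n x))\<^sup>2 \<partial>piece n) \<le> ip (h m - h k) (h m - h k)"
        unfolding ip_self_eq[OF diff] using n by (intro member_le_sum) auto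
      also have "\<dots> \<le> (1/4) ^ k" by (rule fast[OF that])
      finally show ?thesis using nn_integral_eq_integral[OF int]
        by (simp add: coord_diff ennreal_leI)
    qed
    have "AE x in piece n. convergent (\<lambda>k. coord (h k) n x)"
      by (rule AE_convergent_if_fast_L2[OF hmeas bound]) simp
    then have lim: "AE x in piece n. (\<lambda>k. coord (h k) n x) \<longlonglongrightarrow> coord \<xi> n x"
      by eventually_elim (simp add: \<xi>_def coord_def convergent_LIMSEQ_iff)
    have "(\<integral>\<^sup>+ x. ennreal ((norm (coord (\<xi> - h k) n x))\<^sup>2) \<partial>piece n) \<le> ennreal ((1/4) ^ k)"
      unfolding coord_diff by (rule nn_integral_norm_limit_le[OF hmeas lim bound])
    moreover have "coord \<xi> n \<in> borel_measurable (piece n)" using meas n by (rule coord_measurable)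
    then have "(\<lambda>x. (norm (coord (\<xi> - h k) n x))\<^sup>2) \<in> borel_measurable (piece n)"
      unfolding coord_diff using hmeas[of k] by measurable
    ultimately show ?thesis
      by (intro conjI integrableI_bounded integral_real_bounded)
        (auto simp: order.strict_trans1[OF _ ennreal_less_top])
  qed
  \<comment> \<open>The estimates concern differences only; membership of \<open>\<xi>\<close>
    itself follows by adding \<open>h 0\<close> back.\<close>
  have "\<xi> - h 0 \<in> L2_bd Y s"
  proof -
    have "section2_over Y s (bd Y) (\<xi> + (- 1) *\<^sub>R h 0)" "bd_measurable Y (\<xi> + (- 1) *\<^sub>R h 0)"
      using sec meas L2[of 0] section2_over_add section2_over_scaleR bd_measurable_add bd_measurable_scaleR
      by (auto simp only: L2_bd_iff)
    then show ?thesis using step[of _ 0] by (simp add: L2_bd_iff)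
  qed
  then have \<xi>: "\<xi> \<in> L2_bd Y s" using L2_add[OF _ L2[of 0]] by fastforce
  have "ip (h k - \<xi>) (h k - \<xi>) \<le> cover_size * (1/4) ^ k" for k
  proof -
    have "ip (h k - \<xi>) (h k - \<xi>) = ip (\<xi> - h k) (\<xi> - h k)"
      using \<xi> L2[of k] by (simp add: ip_simps V_intros)
    also have "\<dots> \<le> (\<Sum>n<cover_size. (1/4) ^ k)"
      unfolding ip_self_eq[OF V_intros(2)[OF \<xi> L2]] using step by (intro sum_mono) auto
    finally show ?thesis by simp
  qed
  then have bound: "norm (ip (h k - \<xi>) (h k - \<xi>)) \<le> real cover_size * (1/4) ^ k" for k
    using ip_nonneg[OF V_intros(2)[OF L2[of k] \<xi>]] by simp
  have "(\<lambda>k. ip (h k - \<xi>) (h k - \<xi>)) \<longlonglongrightarrow> 0"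
  proof (rule Lim_null_comparison[OF always_eventually[OF allI[OF bound]]])
    show "(\<lambda>k. real cover_size * (1/4) ^ k) \<longlonglongrightarrow> 0"
      by (intro tendsto_mult_right_zero LIMSEQ_power_zero) simp
  qed
  with \<xi> show ?thesis by blast
qed

section \<open>Null sections\<close>

lemma ae_eq_if_null:
  assumes \<psi>: "\<psi> \<in> L2_bd Y s" and \<phi>: "\<phi> \<in> L2_bd Y s" and null: "ip (\<psi> - \<phi>) (\<psi> - \<phi>) = 0"
  shows "ae_eq Y \<psi> \<phi>"
proof -
  define T where "T n = real_trace Y (cov n) (bd_piece Y n)" for n
  define Z where "Z n = {x \<in> T n. coord \<psi> n x \<noteq> coord \<phi> n x}" for n
  have diff: "\<psi> - \<phi> \<in> L2_bd Y s" using \<psi> \<phi> by (rule V_intros)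
  have Z: "negligible (Z n)" if n: "n < cover_size" for n
  proof -
    have "(\<integral>x. (norm (coord (\<psi> - \<phi>) n x))\<^sup>2 \<partial>piece n) = 0"
      using null n unfolding ip_self_eq[OF diff] by (subst (asm) sum_nonneg_eq_0_iff) auto
    then have "AE x in piece n. (norm (coord (\<psi> - \<phi>) n x))\<^sup>2 = 0"
      by (subst (asm) integral_nonneg_eq_0_iff_AE[OF L2_integrable[OF diff n]]) auto
    then have "AE x in lebesgue. x \<in> T n \<longrightarrow> coord \<psi> n x = coord \<phi> n x"
      by (subst (asm) AE_restrict_space_iff) (use piece_sets[OF n] in \<open>auto simp: coord_diff T_def\<close>)
    then obtain N where N: "N \<in> null_sets lebesgue"
      "{x \<in> space lebesgue. \<not> (x \<in> T n \<longrightarrow> coord \<psi> n x = coord \<phi> n x)} \<subseteq> N"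
      by (auto simp: eventually_ae_filter)
    show ?thesis
      by (rule negligible_subset[of N]) (use N in \<open>auto simp: Z_def negligible_iff_null_sets\<close>)
  qed
  have "AE x in lebesgue. x \<in> real_trace Y i (bd Y) \<longrightarrow>
      (\<forall>j\<in>idx Y. inv_chart Y i (of_real x) \<in> cdom Y j \<longrightarrow>
        \<psi> j (inv_chart Y i (of_real x)) = \<phi> j (inv_chart Y i (of_real x)))" if i: "i \<in> idx Y" for i
  proof -
    define R where "R n = real_trace Y (cov n) (cdom Y i)" for n
    \<comment> \<open>The change from the cover chart to chart \<open>i\<close> along the boundary.
      Boundary points have real coordinates in every chart, so \<open>Re\<close> loses nothing
      there.\<close>
    define f where "f n x = Re (transition Y i (cov n) (of_real x))" for n and x :: real
    have "negligible (f n ` (Z n \<inter> R n))" if n: "n < cover_size" for n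
    proof (rule negligible_differentiable_image_negligible[OF order_refl])
      show "negligible (Z n \<inter> R n)" by (rule negligible_subset[OF Z[OF n]]) auto
      \<comment> \<open>The derivative of a transition is given only within the overlap, which at
        the boundary is one-sided in the plane; restricting it to real points is all that the image
        theorem for null sets needs.\<close>
      have "f n differentiable (at x within Z n \<inter> R n)" if x: "x \<in> R n" for x
      proof -
        note c = cov_idx[OF n]
        obtain p where p: "p \<in> cdom Y (cov n)" "p \<in> cdom Y i" "chart Y (cov n) p = of_real x"
          using x unfolding R_def by (metis real_traceE[OF c])
        have sub: "of_real ` (Z n \<inter> R n) \<subseteq> overlap Y i (cov n)"
          unfolding R_def overlap_def real_trace_def by auto
        have "(transition Y i (cov n) has_field_derivative (s i (cov n) p)\<^sup>2)
            (at (of_real x) within overlap Y i (cov n))"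
          using spin i c p by (simp add: spin_structure_def flip: p(3))
        then have D: "(transition Y i (cov n) has_derivative (*) ((s i (cov n) p)\<^sup>2))
            (at (of_real x) within of_real ` (Z n \<inter> R n))"
          unfolding has_field_derivative_def using sub by (rule has_derivative_subset)
        have "((of_real :: real \<Rightarrow> complex) has_derivative of_real) (at x within Z n \<inter> R n)"
          by (rule bounded_linear_imp_has_derivative[OF bounded_linear_of_real])
        from has_derivative_in_compose[OF this D]
        have "((\<lambda>x. transition Y i (cov n) (of_real x)) has_derivative
            (\<lambda>h. (s i (cov n) p)\<^sup>2 * of_real h)) (at x within Z n \<inter> R n)" .
        from bounded_linear.has_derivative[OF bounded_linear_Re this]
        show ?thesis unfolding f_def[abs_def] differentiable_def by blast
      qed
      then show "f n differentiable_on Z n \<inter> R n" by (simp add: differentiable_on_def)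
    qed
    then have "negligible (\<Union>n<cover_size. f n ` (Z n \<inter> R n))"
      by (intro negligible_Union) auto
    then have "AE x in lebesgue. x \<notin> (\<Union>n<cover_size. f n ` (Z n \<inter> R n))"
      by (intro AE_not_in) (simp add: negligible_iff_null_sets)
    then show ?thesis
    proof (rule eventually_mono, intro impI ballI)
      fix x j
      assume nx: "x \<notin> (\<Union>n<cover_size. f n ` (Z n \<inter> R n))"
        and x: "x \<in> real_trace Y i (bd Y)" and j: "j \<in> idx Y" "inv_chart Y i (of_real x) \<in> cdom Y j"
      obtain p where p: "p \<in> cdom Y i" "p \<in> bd Y" "chart Y i p = of_real x"
        "inv_chart Y i (of_real x) = p" using real_traceE[OF i x] by metis
      obtain n where n: "n < cover_size" "p \<in> bd_piece Y n" "p \<in> cdom Y (cov n)"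
        using bd_in_piece[OF p(2)] by metis
      note c = cov_idx[OF n(1)]
      \<comment> \<open>The coordinate of the same boundary point in the cover chart of its piece.
        If it avoids \<open>Z n\<close>, the two sections agree at the point in that chart.\<close>
      define x' where "x' = Re (chart Y (cov n) p)"
      have x': "chart Y (cov n) p = of_real x'"
        using Im_chart_bd[OF p(2) c n(3)] by (simp add: x'_def complex_eq_iff)
      have "x' \<in> T n" "x' \<in> R n"
        unfolding T_def R_def using real_trace_mem_iff[OF c n(3) x'] n(2) p(1) by auto
      moreover have "f n x' = x"
        unfolding f_def x'[symmetric] using transition_chart[OF c n(3)] p(3) by simp
      ultimately have "x' \<notin> Z n" using nx n(1) by force
      then have "coord \<psi> n x' = coord \<phi> n x'" using \<open>x' \<in> T n\<close> by (simp add: Z_def)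
      then have "\<psi> (cov n) p = \<phi> (cov n) p"
        using inv_chart_chart[OF c n(3)] by (simp add: coord_def flip: x')
      moreover have tr: "h j p = s (cov n) j p *s h (cov n) p" if "h \<in> L2_bd Y s" for h
        \<comment> \<open>The cocycle carries the equality from the cover chart to every other chart
          around \<open>p\<close>.\<close>
        using that section2_overD[of "bd Y" h "cov n" j p] c j n(3) p by (auto simp: L2_bd_iff)
      ultimately show "\<psi> j (inv_chart Y i (of_real x)) = \<phi> j (inv_chart Y i (of_real x))"
        using tr[OF \<psi>] tr[OF \<phi>] p(4) by simp
    qed
  qed
  then show ?thesis by (simp add: ae_eq_def AE_bd_def)
qed

section \<open>Boundary values\<close>

text \<open>The conclusion is needed only at boundary points, where the boundary data are
  prescribed. With \<open>P\<close> and \<open>Q\<close> equal this is monotonicity.\<close>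

lemma AE_bd_mp2:
  assumes "AE_bd Y P" "AE_bd Y Q" "\<And>p. \<lbrakk>p \<in> bd Y; P p; Q p\<rbrakk> \<Longrightarrow> R p"
  shows "AE_bd Y R"
  unfolding AE_bd_def
proof
  fix i assume i: "i \<in> idx Y"
  have "AE x in lebesgue. x \<in> real_trace Y i (bd Y) \<longrightarrow> P (inv_chart Y i (of_real x))"
    "AE x in lebesgue. x \<in> real_trace Y i (bd Y) \<longrightarrow> Q (inv_chart Y i (of_real x))"
    using assms(1,2) i by (auto simp: AE_bd_def)
  then show "AE x in lebesgue. x \<in> real_trace Y i (bd Y) \<longrightarrow> R (inv_chart Y i (of_real x))"
  proof eventually_elim
    case (elim x)
    show ?case
    proof
      assume x: "x \<in> real_trace Y i (bd Y)"
      then have "inv_chart Y i (of_real x) \<in> bd Y" by (metis real_traceE[OF i])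
      then show "R (inv_chart Y i (of_real x))" using assms(3) elim x by blast
    qed
  qed
qed

text \<open>Continuity of \<open>H\<close> carries nontangential limits over, and boundedness of
  \<open>H\<close> on bounded sets carries the local bounds over on the smaller of the two radii.
  Sums, pairs and matrix-vector products are the instances used.\<close>

lemma has_boundary_value_combine:
  fixes f :: "'i \<Rightarrow> 'a \<Rightarrow> 'u::real_normed_vector" and g :: "'i \<Rightarrow> 'a \<Rightarrow> 'v::real_normed_vector"
    and H :: "'u \<Rightarrow> 'v \<Rightarrow> 'w::real_normed_vector"
  assumes f: "has_boundary_value Y f \<phi>" and g: "has_boundary_value Y g \<theta>"
    and lim: "\<And>F x y u v. \<lbrakk>(x \<longlongrightarrow> u) F; (y \<longlongrightarrow> v) F\<rbrakk> \<Longrightarrow> ((\<lambda>z::complex. H (x z) (y z)) \<longlongrightarrow> H u v) F"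
    and bound: "\<And>B C. \<exists>D. \<forall>u v. norm u \<le> B \<longrightarrow> norm v \<le> C \<longrightarrow> norm (H u v) \<le> D"
  shows "has_boundary_value Y (\<lambda>i p. H (f i p) (g i p)) (\<lambda>i p. H (\<phi> i p) (\<theta> i p))"
  unfolding has_boundary_value_def
proof (intro conjI ballI)
  fix i p assume i: "i \<in> idx Y" and p: "p \<in> cdom Y i \<inter> bd Y"
  obtain e B where e: "e > 0"
    "\<And>q. \<lbrakk>q \<in> cdom Y i - bd Y; cmod (chart Y i q - chart Y i p) < e\<rbrakk> \<Longrightarrow> norm (f i q) \<le> B"
    using f i p unfolding has_boundary_value_def by meson
  obtain e' C where e': "e' > 0"
    "\<And>q. \<lbrakk>q \<in> cdom Y i - bd Y; cmod (chart Y i q - chart Y i p) < e'\<rbrakk> \<Longrightarrow> norm (g i q) \<le> C"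
    using g i p unfolding has_boundary_value_def by meson
  obtain D where "\<And>u v. \<lbrakk>norm u \<le> B; norm v \<le> C\<rbrakk> \<Longrightarrow> norm (H u v) \<le> D" using bound by meson
  then show "\<exists>e>0. \<exists>B. \<forall>q \<in> cdom Y i - bd Y. cmod (chart Y i q - chart Y i p) < e \<longrightarrow>
      norm (H (f i q) (g i q)) \<le> B"
    using e e' by (intro exI[of _ "min e e'"] conjI exI[of _ D]) auto
next
  show "AE_bd Y (\<lambda>p. \<forall>i\<in>idx Y. p \<in> cdom Y i \<longrightarrow> (\<forall>M>0.
      ((\<lambda>z. H (f i (inv_chart Y i z)) (g i (inv_chart Y i z))) \<longlongrightarrow> H (\<phi> i p) (\<theta> i p))
        (at (chart Y i p) within
           {z \<in> chart Y i ` (cdom Y i - bd Y). \<bar>Re z - Re (chart Y i p)\<bar> \<le> M * Im z})))"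
    using f[unfolded has_boundary_value_def, THEN conjunct2]
      g[unfolded has_boundary_value_def, THEN conjunct2]
    by (rule AE_bd_mp2) (intro ballI impI allI lim; blast)
qed

lemma has_boundary_value_cong:
  assumes "has_boundary_value Y f \<phi>" "\<And>i p. p \<in> bd Y \<Longrightarrow> \<phi> i p = \<theta> i p"
  shows "has_boundary_value Y f \<theta>"
  using assms(1) unfolding has_boundary_value_def
proof (elim conjE, intro conjI)
  assume *: "AE_bd Y (\<lambda>p. \<forall>i\<in>idx Y. p \<in> cdom Y i \<longrightarrow> (\<forall>M>0.
      ((\<lambda>z. f i (inv_chart Y i z)) \<longlongrightarrow> \<phi> i p) (at (chart Y i p) within
           {z \<in> chart Y i ` (cdom Y i - bd Y). \<bar>Re z - Re (chart Y i p)\<bar> \<le> M * Im z})))"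
  from * * show "AE_bd Y (\<lambda>p. \<forall>i\<in>idx Y. p \<in> cdom Y i \<longrightarrow> (\<forall>M>0.
      ((\<lambda>z. f i (inv_chart Y i z)) \<longlongrightarrow> \<theta> i p) (at (chart Y i p) within
           {z \<in> chart Y i ` (cdom Y i - bd Y). \<bar>Re z - Re (chart Y i p)\<bar> \<le> M * Im z})))"
    by (rule AE_bd_mp2) (simp add: assms(2))
qed

lemma holomorphic_boundary_value_cong:
  "\<lbrakk>holomorphic_boundary_value Y a; \<And>p. p \<in> bd Y \<Longrightarrow> a p = b p\<rbrakk> \<Longrightarrow> holomorphic_boundary_value Y b"
  unfolding holomorphic_boundary_value_def by (blast intro: has_boundary_value_cong)

lemma has_boundary_value_const: "has_boundary_value Y (\<lambda>i p. m) (\<lambda>i p. m)"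
  unfolding has_boundary_value_def
proof (intro conjI ballI)
  show "\<exists>e>0. \<exists>B. \<forall>q \<in> cdom Y i - bd Y. cmod (chart Y i q - chart Y i p) < e \<longrightarrow> norm m \<le> B" for i p
    by (intro exI[of _ 1] conjI exI[of _ "norm m"]) auto
qed (simp add: AE_bd_def)

lemma holomorphic_boundary_value_const: "holomorphic_boundary_value Y (\<lambda>p. m)"
  unfolding holomorphic_boundary_value_def
  by (intro exI[of _ "\<lambda>p. m"] conjI ballI has_boundary_value_const) (simp add: comp_def)

lemma norm_vector2_le: "norm (vector [u, v] :: 'v ^ 2) \<le> norm u + norm v"
  for u v :: "'v::real_normed_vector"
  unfolding norm_vec_def by (rule order_trans[OF L2_set_le_sum]) (simp_all add: sum_2)

lemma tendsto_vector2:
  fixes u v :: "'v::real_normed_vector"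
  assumes "(x \<longlongrightarrow> u) F" "(y \<longlongrightarrow> v) F"
  shows "((\<lambda>z. vector [x z, y z] :: 'v ^ 2) \<longlongrightarrow> vector [u, v]) F"
proof (rule vec_tendstoI)
  fix k :: 2
  show "((\<lambda>z. vector [x z, y z] $ k) \<longlongrightarrow> vector [u, v] $ k) F"
    using assms exhaust_2[of k] by auto
qed

text \<open>Nesting this twice assembles a matrix from boundary values of its entries.\<close>

lemma has_boundary_value_vector2:
  fixes f g :: "'i \<Rightarrow> 'a \<Rightarrow> 'v::real_normed_vector"
  assumes "has_boundary_value Y f \<phi>" "has_boundary_value Y g \<theta>"
  shows "has_boundary_value Y (\<lambda>i p. vector [f i p, g i p] :: 'v ^ 2) (\<lambda>i p. vector [\<phi> i p, \<theta> i p])"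
proof (rule has_boundary_value_combine[OF assms])
  fix B C :: real
  show "\<exists>D. \<forall>u v. norm u \<le> B \<longrightarrow> norm v \<le> C \<longrightarrow> norm (vector [u, v] :: 'v ^ 2) \<le> D"
    by (intro exI[of _ "B + C"] allI impI order_trans[OF norm_vector2_le] add_mono)
qed (rule tendsto_vector2)

lemma vector2_eta: "vector [x $ 1, x $ 2] = (x :: 'v::zero ^ 2)"
  by (simp add: vec_eq_iff forall_2)

section \<open>The Hardy space\<close>

text \<open>The local bounds of the extensions, contained in
  \<open>holomorphic_boundary_value\<close>, make products of traces traces; the global bound
  \<open>B\<close> on the boundary makes multiplication continuous, so that it passes to the
  closure.\<close>

definition holomorphic_multiplier :: "('a \<Rightarrow> complex ^ 2 ^ 2) \<Rightarrow> bool" where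
  "holomorphic_multiplier G \<longleftrightarrow> bd_measurable Y (\<lambda>i. G) \<and>
     (\<forall>k l. holomorphic_boundary_value Y (\<lambda>p. G p $ k $ l)) \<and>
     (\<exists>B. \<forall>p\<in>bd Y. \<forall>k l. cmod (G p $ k $ l) \<le> B)"

lemma holomorphic_multiplier_const: "holomorphic_multiplier (\<lambda>p. m)"
  unfolding holomorphic_multiplier_def
proof (intro conjI bd_measurable_const allI holomorphic_boundary_value_const exI ballI)
  fix k l :: 2
  have "cmod (m $ k $ l) \<le> norm (m $ k)" by (rule Finite_Cartesian_Product.norm_nth_le)
  also have "\<dots> \<le> norm m" by (rule Finite_Cartesian_Product.norm_nth_le)
  finally show "cmod (m $ k $ l) \<le> norm m" .
qed

text \<open>The dense part of \<open>H_plus\<close>, before closure.\<close>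

definition holomorphic_traces :: "('i \<Rightarrow> 'a \<Rightarrow> complex ^ 2) set" where
  "holomorphic_traces = {\<phi> \<in> L2_bd Y s. \<exists>f. holomorphic_section2 Y s f \<and> has_boundary_value Y f \<phi>}"

lemma holomorphic_traces_add:
  assumes "\<phi> \<in> holomorphic_traces" "\<theta> \<in> holomorphic_traces"
  shows "\<phi> + \<theta> \<in> holomorphic_traces"
proof -
  obtain f where f: "holomorphic_section2 Y s f" "has_boundary_value Y f \<phi>" and \<phi>: "\<phi> \<in> L2_bd Y s"
    using assms(1) by (auto simp: holomorphic_traces_def)
  obtain g where g: "holomorphic_section2 Y s g" "has_boundary_value Y g \<theta>" and \<theta>: "\<theta> \<in> L2_bd Y s"
    using assms(2) by (auto simp: holomorphic_traces_def)
  have "holomorphic_section2 Y s (f + g)"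
    using f(1) g(1) unfolding holomorphic_section2_def
    by (auto intro!: section2_over_add holomorphic_on_add)
  moreover have "has_boundary_value Y (f + g) (\<phi> + \<theta>)"
    unfolding plus_fun_def
  proof (rule has_boundary_value_combine[OF f(2) g(2)])
    fix B C :: real
    show "\<exists>D. \<forall>u v :: complex ^ 2. norm u \<le> B \<longrightarrow> norm v \<le> C \<longrightarrow> norm (u + v) \<le> D"
      by (intro exI[of _ "B + C"] allI impI order_trans[OF norm_triangle_ineq] add_mono)
  qed (rule tendsto_add)
  ultimately show ?thesis using L2_add[OF \<phi> \<theta>] by (auto simp: holomorphic_traces_def)
qed

lemma holomorphic_traces_mult:
  assumes G: "holomorphic_multiplier G" and "\<phi> \<in> holomorphic_traces"
  shows "mult_op G \<phi> \<in> holomorphic_traces"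
proof -
  obtain f where f: "holomorphic_section2 Y s f" "has_boundary_value Y f \<phi>" and \<phi>: "\<phi> \<in> L2_bd Y s"
    using assms(2) by (auto simp: holomorphic_traces_def)
  have "\<forall>k l. \<exists>F. (\<forall>i\<in>idx Y. (F \<circ> inv_chart Y i) holomorphic_on chart Y i ` (cdom Y i - bd Y)) \<and>
      has_boundary_value Y (\<lambda>i. F) (\<lambda>i p. G p $ k $ l)"
    using G by (simp add: holomorphic_multiplier_def holomorphic_boundary_value_def)
  then obtain F where F: "\<And>k l i. i \<in> idx Y \<Longrightarrow>
        (F k l \<circ> inv_chart Y i) holomorphic_on chart Y i ` (cdom Y i - bd Y)"
      "\<And>k l. has_boundary_value Y (\<lambda>i. F k l) (\<lambda>i p. G p $ k $ l)"
    by metis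
  define E :: "'a \<Rightarrow> complex ^ 2 ^ 2" where "E p = (\<chi> k l. F k l p)" for p
  have "has_boundary_value Y (\<lambda>i p. vector [vector [F 1 1 p, F 1 2 p], vector [F 2 1 p, F 2 2 p]])
      (\<lambda>i p. vector [vector [G p $ 1 $ 1, G p $ 1 $ 2], vector [G p $ 2 $ 1, G p $ 2 $ 2]] :: complex ^ 2 ^ 2)"
    by (intro has_boundary_value_vector2 F(2))
  moreover have "vector [vector [F 1 1 p, F 1 2 p], vector [F 2 1 p, F 2 2 p]] = E p" for p
    by (simp add: E_def vec_eq_iff forall_2)
  ultimately have E: "has_boundary_value Y (\<lambda>i. E) (\<lambda>i. G)" by (simp add: vector2_eta)
  have "has_boundary_value Y (mult_op E f) (mult_op G \<phi>)"
    unfolding mult_op_def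
  proof (rule has_boundary_value_combine[OF E f(2)])
    show "((\<lambda>z. x z *v y z) \<longlongrightarrow> u *v v) F"
      if "(x \<longlongrightarrow> u) F" "(y \<longlongrightarrow> v) F" for F u v and x :: "complex \<Rightarrow> complex ^ 2 ^ 2" and y :: "complex \<Rightarrow> complex ^ 2"
      unfolding matrix_vector_mult_def using that by (intro tendsto_intros)
    fix B C :: real
    show "\<exists>D. \<forall>(u :: complex ^ 2 ^ 2) (v :: complex ^ 2).
        norm u \<le> B \<longrightarrow> norm v \<le> C \<longrightarrow> norm (u *v v) \<le> D"
    proof (intro exI allI impI)
      fix u :: "complex ^ 2 ^ 2" and v :: "complex ^ 2"
      assume u: "norm u \<le> B" and v: "norm v \<le> C"
      have "cmod (u $ k $ l) \<le> norm u" for k l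
        by (rule order_trans[OF Finite_Cartesian_Product.norm_nth_le Finite_Cartesian_Product.norm_nth_le])
      then have "norm (u *v v) \<le> 4 * norm u * norm v" by (rule norm_matrix_vector_mult_le)
      also have "\<dots> \<le> 4 * B * C"
        using u v by (intro mult_mono) (auto intro: order_trans[OF norm_ge_zero])
      finally show "norm (u *v v) \<le> 4 * B * C" .
    qed
  qed
  moreover have "holomorphic_section2 Y s (mult_op E f)"
    unfolding holomorphic_section2_def
  proof (intro conjI ballI allI)
    show "section2_over Y s (- bd Y) (mult_op E f)"
      using f(1) by (intro section2_over_mult_op) (simp add: holomorphic_section2_def)
    fix i l assume i: "i \<in> idx Y"
    have "(\<lambda>z. \<Sum>m\<in>UNIV. (F l m \<circ> inv_chart Y i) z * f i (inv_chart Y i z) $ m)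
        holomorphic_on chart Y i ` (cdom Y i - bd Y)"
      using f(1) i by (intro holomorphic_on_sum holomorphic_on_mult F(1))
        (auto simp: holomorphic_section2_def)
    then show "(\<lambda>z. mult_op E f i (inv_chart Y i z) $ l) holomorphic_on chart Y i ` (cdom Y i - bd Y)"
      by (simp add: mult_op_def matrix_vector_mult_def E_def)
  qed
  moreover have "mult_op G \<phi> \<in> L2_bd Y s"
    using G L2_mult_op(1)[OF \<phi>] unfolding holomorphic_multiplier_def by blast
  ultimately show ?thesis by (auto simp: holomorphic_traces_def)
qed

lemma holomorphic_traces_zero: "0 \<in> holomorphic_traces"
proof -
  have "holomorphic_section2 Y s 0"
    by (auto simp: holomorphic_section2_def vec_eq_iff intro!: section2_overI)
  moreover have "has_boundary_value Y 0 (0 :: 'i \<Rightarrow> 'a \<Rightarrow> complex ^ 2)"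
    unfolding zero_fun_def by (rule has_boundary_value_const)
  ultimately show ?thesis using L2_zero by (auto simp: holomorphic_traces_def)
qed

text \<open>Trading \<open>e\<close> for its square removes the root from the norm, so that the
  semi-definite form can be used directly.\<close>

lemma H_plus_iff:
  "\<psi> \<in> H_plus Y s \<longleftrightarrow> \<psi> \<in> L2_bd Y s \<and> (\<forall>e>0. \<exists>\<phi>\<in>holomorphic_traces. ip (\<psi> - \<phi>) (\<psi> - \<phi>) < e)"
proof -
  have "(\<lambda>i p. \<psi> i p - \<phi> i p) = \<psi> - \<phi>" for \<phi> by (simp add: fun_eq_iff fun_diff_def)
  then have "\<psi> \<in> H_plus Y s \<longleftrightarrow>
      \<psi> \<in> L2_bd Y s \<and> (\<forall>e>0. \<exists>\<phi>\<in>holomorphic_traces. sqrt (ip (\<psi> - \<phi>) (\<psi> - \<phi>)) < e)"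
    by (auto simp: H_plus_def holomorphic_traces_def norm_bd_eq) blast+
  also have "(\<forall>e>0. \<exists>\<phi>\<in>holomorphic_traces. sqrt (ip (\<psi> - \<phi>) (\<psi> - \<phi>)) < e) \<longleftrightarrow>
      (\<forall>e>0. \<exists>\<phi>\<in>holomorphic_traces. ip (\<psi> - \<phi>) (\<psi> - \<phi>) < e)" (is "?l = ?r")
  proof
    assume ?l
    then show ?r by (metis real_sqrt_gt_0_iff real_sqrt_less_iff)
  next
    assume r: ?r
    show ?l
    proof (intro allI impI)
      fix e :: real assume e: "e > 0"
      then obtain \<phi> where "\<phi> \<in> holomorphic_traces" "ip (\<psi> - \<phi>) (\<psi> - \<phi>) < e\<^sup>2"
        using r by (meson zero_less_power)
      then show "\<exists>\<phi>\<in>holomorphic_traces. sqrt (ip (\<psi> - \<phi>) (\<psi> - \<phi>)) < e"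
        using e by (metis real_sqrt_less_iff real_sqrt_abs abs_of_pos)
    qed
  qed
  finally show ?thesis .
qed

lemma H_plus_L2: "\<psi> \<in> H_plus Y s \<Longrightarrow> \<psi> \<in> L2_bd Y s"
  by (simp add: H_plus_iff)

lemma holomorphic_traces_L2: "\<psi> \<in> holomorphic_traces \<Longrightarrow> \<psi> \<in> L2_bd Y s"
  by (simp add: holomorphic_traces_def)

text \<open>Multiplication maps traces to traces and enlarges squared distances at most by the
  factor \<open>16 * B\<^sup>2\<close>.\<close>

lemma H_plus_mult:
  assumes G: "holomorphic_multiplier G" and \<psi>: "\<psi> \<in> H_plus Y s"
  shows "mult_op G \<psi> \<in> H_plus Y s"
  unfolding H_plus_iff
proof (intro conjI allI impI)
  obtain B where meas: "bd_measurable Y (\<lambda>i. G)" and B: "\<And>p k l. p \<in> bd Y \<Longrightarrow> cmod (G p $ k $ l) \<le> B"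
    using G unfolding holomorphic_multiplier_def by blast
  show "mult_op G \<psi> \<in> L2_bd Y s" by (rule L2_mult_op(1)[OF H_plus_L2[OF \<psi>] meas B])
  fix e :: real assume e: "e > 0"
  \<comment> \<open>The added 1 keeps the divisor positive when \<open>B\<close> is 0.\<close>
  have pos: "16 * B\<^sup>2 + 1 > 0" by (intro add_nonneg_pos) auto
  then have "e / (16 * B\<^sup>2 + 1) > 0" using e by simp
  then obtain \<phi> where \<phi>: "\<phi> \<in> holomorphic_traces" "ip (\<psi> - \<phi>) (\<psi> - \<phi>) < e / (16 * B\<^sup>2 + 1)"
    using \<psi> unfolding H_plus_iff by blast
  have diff: "\<psi> - \<phi> \<in> L2_bd Y s"
    by (intro V_intros H_plus_L2 holomorphic_traces_L2 \<psi> \<phi>(1))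
  have "ip (mult_op G \<psi> - mult_op G \<phi>) (mult_op G \<psi> - mult_op G \<phi>) \<le> 16 * B\<^sup>2 * ip (\<psi> - \<phi>) (\<psi> - \<phi>)"
    unfolding mult_op_diff[symmetric] by (rule ip_mult_op_le[OF diff meas B])
  also have "\<dots> \<le> (16 * B\<^sup>2 + 1) * ip (\<psi> - \<phi>) (\<psi> - \<phi>)"
    using ip_nonneg[OF diff] by (simp add: algebra_simps)
  also have "\<dots> < e" using \<phi>(2) pos by (simp add: field_simps)
  finally show "\<exists>\<phi>\<in>holomorphic_traces. ip (mult_op G \<psi> - \<phi>) (mult_op G \<psi> - \<phi>) < e"
    using holomorphic_traces_mult[OF G \<phi>(1)] by blast
qed

lemma H_plus_add:
  assumes \<psi>: "\<psi> \<in> H_plus Y s" "\<psi>' \<in> H_plus Y s"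
  shows "\<psi> + \<psi>' \<in> H_plus Y s"
  unfolding H_plus_iff
proof (intro conjI allI impI)
  show "\<psi> + \<psi>' \<in> L2_bd Y s" using \<psi> by (intro L2_add H_plus_L2)
  fix e :: real assume "e > 0"
  \<comment> \<open>Without square roots the triangle inequality costs a factor 2 on each of the two
    terms.\<close>
  then have e4: "e / 4 > 0" by simp
  obtain \<phi> where \<phi>: "\<phi> \<in> holomorphic_traces" "ip (\<psi> - \<phi>) (\<psi> - \<phi>) < e / 4"
    using \<psi>(1) e4 unfolding H_plus_iff by blast
  obtain \<phi>' where \<phi>': "\<phi>' \<in> holomorphic_traces" "ip (\<psi>' - \<phi>') (\<psi>' - \<phi>') < e / 4"
    using \<psi>(2) e4 unfolding H_plus_iff by blast
  have "ip ((\<psi> - \<phi>) + (\<psi>' - \<phi>')) ((\<psi> - \<phi>) + (\<psi>' - \<phi>'))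
      \<le> 2 * ip (\<psi> - \<phi>) (\<psi> - \<phi>) + 2 * ip (\<psi>' - \<phi>') (\<psi>' - \<phi>')"
    by (intro ip_norm_add_le V_intros H_plus_L2 holomorphic_traces_L2 \<psi> \<phi>(1) \<phi>'(1))
  also have "\<dots> < e" using \<phi>(2) \<phi>'(2) by simp
  finally have "ip (\<psi> + \<psi>' - (\<phi> + \<phi>')) (\<psi> + \<psi>' - (\<phi> + \<phi>')) < e"
    by (simp add: add_diff_add)
  then show "\<exists>\<phi>\<in>holomorphic_traces. ip (\<psi> + \<psi>' - \<phi>) (\<psi> + \<psi>' - \<phi>) < e"
    using holomorphic_traces_add[OF \<phi>(1) \<phi>'(1)] by blast
qed

lemma subspace_H_plus: "subspace (H_plus Y s)"
proof (rule subspaceI)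
  show "0 \<in> H_plus Y s"
    unfolding H_plus_iff using L2_zero ip_self_eq[OF L2_zero]
    by (auto intro!: bexI[OF _ holomorphic_traces_zero] simp: coord_def)
  fix r \<psi> assume \<psi>: "\<psi> \<in> H_plus Y s"
  \<comment> \<open>Scaling is multiplication by a constant matrix, so stability under multipliers
    covers it.\<close>
  have "mat (of_real r) *v v = r *\<^sub>R v" for v :: "complex ^ 2"
    by (simp add: vec_eq_iff forall_2 matrix_vector_mult_def mat_def sum_2
      scaleR_conv_of_real[where 'a = complex])
  then have "r *\<^sub>R \<psi> = mult_op (\<lambda>p. mat (of_real r)) \<psi>"
    by (simp add: mult_op_def fun_eq_iff)
  then show "r *\<^sub>R \<psi> \<in> H_plus Y s"
    using H_plus_mult[OF holomorphic_multiplier_const \<psi>] by metis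
qed (rule H_plus_add)

lemma H_plus_closed:
  assumes \<psi>: "\<psi> \<in> L2_bd Y s" and approx: "\<And>e. e > 0 \<Longrightarrow> \<exists>\<phi>\<in>H_plus Y s. ip (\<phi> - \<psi>) (\<phi> - \<psi>) < e"
  shows "\<psi> \<in> H_plus Y s"
  unfolding H_plus_iff
proof (intro conjI allI impI \<psi>)
  fix e :: real assume "e > 0"
  then have e4: "e / 4 > 0" by simp
  obtain \<phi> where \<phi>: "\<phi> \<in> H_plus Y s" "ip (\<phi> - \<psi>) (\<phi> - \<psi>) < e / 4" using approx[OF e4] by blast
  obtain \<theta> where \<theta>: "\<theta> \<in> holomorphic_traces" "ip (\<phi> - \<theta>) (\<phi> - \<theta>) < e / 4"
    using \<phi>(1) e4 unfolding H_plus_iff by blast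
  have L2: "\<phi> \<in> L2_bd Y s" "\<theta> \<in> L2_bd Y s"
    using \<phi>(1) \<theta>(1) by (auto intro: H_plus_L2 holomorphic_traces_L2)
  have "ip (\<psi> - \<phi>) (\<psi> - \<phi>) = ip (\<phi> - \<psi>) (\<phi> - \<psi>)"
    using \<psi> L2 by (simp add: ip_simps V_intros)
  moreover have "ip ((\<psi> - \<phi>) + (\<phi> - \<theta>)) ((\<psi> - \<phi>) + (\<phi> - \<theta>))
      \<le> 2 * ip (\<psi> - \<phi>) (\<psi> - \<phi>) + 2 * ip (\<phi> - \<theta>) (\<phi> - \<theta>)"
    by (intro ip_norm_add_le V_intros \<psi> L2)
  ultimately have "ip (\<psi> - \<theta>) (\<psi> - \<theta>) < e" using \<phi>(2) \<theta>(2) by simp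
  then show "\<exists>\<phi>\<in>holomorphic_traces. ip (\<psi> - \<phi>) (\<psi> - \<phi>) < e" using \<theta>(1) by blast
qed

section \<open>Compressions\<close>

lemma H_plus_projection_exists:
  assumes g: "g \<in> L2_bd Y s"
  shows "\<exists>\<xi>\<in>H_plus Y s. \<forall>\<eta>\<in>H_plus Y s. ip (g - \<xi>) \<eta> = 0"
proof (rule projection_exists[OF subspace_H_plus _ g])
  show "H_plus Y s \<subseteq> L2_bd Y s" using H_plus_L2 by blast
  fix h assume h: "\<And>n :: nat. h n \<in> H_plus Y s"
    and fast: "\<And>m n. n \<le> m \<Longrightarrow> ip (h m - h n) (h m - h n) \<le> (1/4) ^ n"
  obtain \<xi> where \<xi>: "\<xi> \<in> L2_bd Y s" and lim: "(\<lambda>n. ip (h n - \<xi>) (h n - \<xi>)) \<longlonglongrightarrow> 0"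
    using L2_complete[OF H_plus_L2[OF h] fast] by blast
  have "\<xi> \<in> H_plus Y s"
  proof (rule H_plus_closed[OF \<xi>])
    fix e :: real assume "e > 0"
    then have "\<forall>\<^sub>F n in sequentially. ip (h n - \<xi>) (h n - \<xi>) < e" by (rule order_tendstoD(2)[OF lim])
    then obtain n where "ip (h n - \<xi>) (h n - \<xi>) < e" by (auto simp: eventually_sequentially)
    then show "\<exists>\<phi>\<in>H_plus Y s. ip (\<phi> - \<xi>) (\<phi> - \<xi>) < e" using h by blast
  qed
  with lim show "\<exists>\<xi>\<in>H_plus Y s. (\<lambda>n. ip (h n - \<xi>) (h n - \<xi>)) \<longlonglongrightarrow> 0" by blast
qed

text \<open>\<open>H_plus\<close> is stable under the constant multiplier \<open>mat \<i>\<close>,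
  so testing real parts against all of it tests imaginary parts as well.\<close>

lemma orthogonal_H_plus_iff:
  "(\<forall>\<eta>\<in>H_plus Y s. inner_bd Y \<psi> \<eta> = 0) \<longleftrightarrow> (\<forall>\<eta>\<in>H_plus Y s. ip \<psi> \<eta> = 0)"
  unfolding inner_bd_eq_0_iff using H_plus_mult[OF holomorphic_multiplier_const] by blast

lemma A_op:
  assumes "mult_op g \<psi> \<in> L2_bd Y s"
  shows A_op_H_plus: "A_op Y s g \<psi> \<in> H_plus Y s"
    and A_op_orthogonal: "\<And>\<eta>. \<eta> \<in> H_plus Y s \<Longrightarrow> ip (mult_op g \<psi> - A_op Y s g \<psi>) \<eta> = 0"
proof -
  have diff: "(\<lambda>i p. mult_op g \<psi> i p - \<xi> i p) = mult_op g \<psi> - \<xi>" for \<xi>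
    by (simp add: fun_eq_iff fun_diff_def)
  define P where "P \<xi> \<longleftrightarrow> \<xi> \<in> H_plus Y s \<and> (\<forall>\<eta>\<in>H_plus Y s. ip (mult_op g \<psi> - \<xi>) \<eta> = 0)" for \<xi>
  have "A_op Y s g \<psi> = (SOME \<xi>. P \<xi>)"
    unfolding A_op_def orthogonal_H_plus_iff diff P_def ..
  moreover have "\<exists>\<xi>. P \<xi>"
    using H_plus_projection_exists[OF assms] unfolding P_def by blast
  ultimately have "P (A_op Y s g \<psi>)" by (simp only: someI_ex)
  then show "A_op Y s g \<psi> \<in> H_plus Y s"
    and "\<And>\<eta>. \<eta> \<in> H_plus Y s \<Longrightarrow> ip (mult_op g \<psi> - A_op Y s g \<psi>) \<eta> = 0"
    by (auto simp: P_def)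
qed

text \<open>The difference of two projections lies in \<open>H_plus\<close> and is orthogonal to
  \<open>H_plus\<close>, hence to itself; being null, it vanishes almost everywhere.\<close>

lemma A_op_unique:
  assumes g: "mult_op g \<psi> \<in> L2_bd Y s" and \<xi>: "\<xi> \<in> H_plus Y s"
    and orth: "\<And>\<eta>. \<eta> \<in> H_plus Y s \<Longrightarrow> ip (mult_op g \<psi> - \<xi>) \<eta> = 0"
  shows "ae_eq Y (A_op Y s g \<psi>) \<xi>"
proof (rule ae_eq_if_null)
  let ?A = "A_op Y s g \<psi>"
  have A: "?A \<in> H_plus Y s" by (rule A_op_H_plus[OF g])
  show AL2: "?A \<in> L2_bd Y s" and \<xi>L2: "\<xi> \<in> L2_bd Y s" using A \<xi> by (auto intro: H_plus_L2)
  have mem: "?A - \<xi> \<in> H_plus Y s" by (rule subspace_diff[OF subspace_H_plus A \<xi>])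
  have "ip (?A - \<xi>) (?A - \<xi>) = ip (mult_op g \<psi> - \<xi>) (?A - \<xi>) - ip (mult_op g \<psi> - ?A) (?A - \<xi>)"
    using g AL2 \<xi>L2 by (simp add: ip_diff_left V_intros)
  also have "\<dots> = 0" using orth[OF mem] A_op_orthogonal[OF g mem] by simp
  finally show "ip (?A - \<xi>) (?A - \<xi>) = 0" .
qed

lemma bd_measurable_compose:
  assumes "continuous_on UNIV f" "bd_measurable Y (\<lambda>i. k)"
  shows "bd_measurable Y (\<lambda>i p. f (k p))"
  unfolding bd_measurable_def
proof
  fix i assume "i \<in> idx Y"
  with assms(2) have "(\<lambda>x. k (inv_chart Y i (of_real x)))
      \<in> borel_measurable (lebesgue_on (real_trace Y i (bd Y)))"
    by (simp add: bd_measurable_def)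
  with assms(1) show "(\<lambda>x. f (k (inv_chart Y i (of_real x))))
      \<in> borel_measurable (lebesgue_on (real_trace Y i (bd Y)))"
    by (rule borel_measurable_continuous_on)
qed

end

section \<open>Entries of SU(2) matrices and coordinate projections\<close>

text \<open>The rows of a unitary matrix are unit vectors.\<close>

lemma SU2_entry_le:
  fixes m :: "complex ^ 2 ^ 2"
  assumes "m \<in> SU2"
  shows "cmod (m $ k $ l) \<le> 1"
proof -
  have "(m ** hermitian_adjoint m) $ k $ k = 1" using assms by (simp add: SU2_def mat_def)
  then have "complex_of_real (\<Sum>l\<in>UNIV. (cmod (m $ k $ l))\<^sup>2) = 1"
    unfolding matrix_matrix_mult_def hermitian_adjoint_def by (simp flip: complex_norm_square)
  then have "(\<Sum>l\<in>UNIV. (cmod (m $ k $ l))\<^sup>2) = 1" using of_real_eq_1_iff by blast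
  moreover have "(cmod (m $ k $ l))\<^sup>2 \<le> (\<Sum>l\<in>UNIV. (cmod (m $ k $ l))\<^sup>2)"
    by (rule member_le_sum) auto
  ultimately show ?thesis by (simp add: power_le_one_iff)
qed

text \<open>Taking a component is encoded as a constant matrix, so that it is itself a holomorphic
  multiplier and composes with loops by matrix multiplication.\<close>

definition coord_proj :: "2 \<Rightarrow> complex ^ 2 ^ 2" where
  "coord_proj m = (\<chi> k l. if k = m \<and> l = m then 1 else 0)"

lemma coord_proj_mult: "(coord_proj m ** g) $ k $ l = (if k = m then g $ m $ l else 0)"
  for g :: "complex ^ 2 ^ 2"
  using exhaust_2[of k] exhaust_2[of m]
  by (auto simp: coord_proj_def matrix_matrix_mult_def sum_2)

lemma coord_proj_adjoint: "hermitian_adjoint (coord_proj m) = coord_proj m"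
  by (auto simp: coord_proj_def hermitian_adjoint_def vec_eq_iff)

lemma coord_proj_idem: "coord_proj m *v (coord_proj m *v v) = coord_proj m *v v"
  by (simp add: coord_proj_def matrix_vector_mult_def vec_eq_iff forall_2 sum_2)

lemma coord_proj_sum: "coord_proj 1 *v v + coord_proj 2 *v v = v"
  by (simp add: coord_proj_def matrix_vector_mult_def vec_eq_iff forall_2 sum_2)

context bordered_spin_surface
begin

section \<open>Multiplicativity of the compression\<close>

text \<open>Row \<open>m\<close> is kept and the other row becomes the constant 0, which is
  holomorphic.\<close>

lemma holomorphic_multiplier_row:
  fixes k :: "'a \<Rightarrow> complex ^ 2 ^ 2"
  assumes k: "measurable_multiloop Y k"
    and row: "\<And>l. holomorphic_boundary_value Y (\<lambda>p. k p $ m $ l)"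
  shows "holomorphic_multiplier (\<lambda>p. coord_proj m ** k p)"
  unfolding holomorphic_multiplier_def
proof (intro conjI allI exI ballI)
  have "continuous_on UNIV (\<lambda>g. coord_proj m ** g :: complex ^ 2 ^ 2)"
    unfolding matrix_matrix_mult_def by (intro continuous_intros)
  then show "bd_measurable Y (\<lambda>i p. coord_proj m ** k p)"
    by (rule bd_measurable_compose) (use k in \<open>simp add: measurable_multiloop_def\<close>)
  fix j l
  show "holomorphic_boundary_value Y (\<lambda>p. (coord_proj m ** k p) $ j $ l)"
    by (cases "j = m") (simp_all add: coord_proj_mult row holomorphic_boundary_value_const)
  fix p assume "p \<in> bd Y"
  then show "cmod ((coord_proj m ** k p) $ j $ l) \<le> 1"
    using k SU2_entry_le[of "k p"] by (simp add: coord_proj_mult measurable_multiloop_def)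
qed

text \<open>In block notation the failure of multiplicativity is a composite of off-diagonal blocks:
  the one of \<open>k2\<close> from \<open>H_plus\<close> to its orthogonal complement, then the one
  of the adjoint of \<open>k1\<close> back. The condition on \<open>k2\<close> confines the range of
  the former to the first component, and the condition on \<open>k1\<close> makes the latter vanish
  there.\<close>

lemma A_op_adjoint_mult:
  fixes k1 k2 :: "'a \<Rightarrow> complex ^ 2 ^ 2"
  assumes k1: "measurable_multiloop Y k1" and k2: "measurable_multiloop Y k2"
    and row1: "\<And>l. holomorphic_boundary_value Y (\<lambda>p. k1 p $ 1 $ l)"
    and row2: "\<And>l. holomorphic_boundary_value Y (\<lambda>p. k2 p $ 2 $ l)"
    and \<psi>: "\<psi> \<in> H_plus Y s"
  shows "ae_eq Y (A_op Y s (\<lambda>p. hermitian_adjoint (k1 p) ** k2 p) \<psi>)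
    (A_op Y s (\<lambda>p. hermitian_adjoint (k1 p)) (A_op Y s k2 \<psi>))"
proof -
  define k1' where "k1' = (\<lambda>p. hermitian_adjoint (k1 p))"
  define E :: "2 \<Rightarrow> ('i \<Rightarrow> 'a \<Rightarrow> complex ^ 2) \<Rightarrow> 'i \<Rightarrow> 'a \<Rightarrow> complex ^ 2"
    where "E m = mult_op (\<lambda>p::'a. coord_proj m)" for m :: 2
  have meas: "bd_measurable Y (\<lambda>i. k1)" "bd_measurable Y (\<lambda>i. k2)"
    using k1 k2 by (auto simp: measurable_multiloop_def)
  have bound: "cmod (k1 p $ k $ l) \<le> 1" "cmod (k2 p $ k $ l) \<le> 1" "cmod (k1' p $ k $ l) \<le> 1"
    if "p \<in> bd Y" for p k l
    using that k1 k2 SU2_entry_le by (auto simp: measurable_multiloop_def k1'_def hermitian_adjoint_def)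
  have "continuous_on UNIV hermitian_adjoint"
    unfolding hermitian_adjoint_def by (intro continuous_intros)
  then have meas': "bd_measurable Y (\<lambda>i. k1')"
    unfolding k1'_def using meas(1) by (rule bd_measurable_compose)
  have L2: "mult_op k1 h \<in> L2_bd Y s" "mult_op k2 h \<in> L2_bd Y s" "mult_op k1' h \<in> L2_bd Y s"
    if "h \<in> L2_bd Y s" for h
    using L2_mult_op(1)[OF that meas(1) bound(1)] L2_mult_op(1)[OF that meas(2) bound(2)]
      L2_mult_op(1)[OF that meas' bound(3)] by auto
  have E_mult: "E m (mult_op k h) \<in> H_plus Y s"
    if "holomorphic_multiplier (\<lambda>p. coord_proj m ** k p)" "h \<in> H_plus Y s" for m k h
    using H_plus_mult[OF that] by (simp add: E_def mult_op_def matrix_vector_mul_assoc)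
  have E_H: "E m h \<in> H_plus Y s" if "h \<in> H_plus Y s" for m h
    unfolding E_def using that by (intro H_plus_mult holomorphic_multiplier_const)
  have E_L2: "E m h \<in> L2_bd Y s" if "h \<in> L2_bd Y s" for m h
    unfolding E_def by (rule L2_mult_op(1)[OF that bd_measurable_const, where B = 1])
      (simp add: coord_proj_def)
  have E_selfadjoint: "ip (E m x) y = ip x (E m y)" for m x y
    using ip_mult_op_adjoint[of "\<lambda>p. coord_proj m"] by (simp add: coord_proj_adjoint E_def)
  define \<xi> where "\<xi> = A_op Y s k2 \<psi>"
  define \<eta> where "\<eta> = mult_op k2 \<psi> - \<xi>"
  have k2\<psi>: "mult_op k2 \<psi> \<in> L2_bd Y s" by (intro L2 H_plus_L2 \<psi>)
  have \<xi>: "\<xi> \<in> H_plus Y s" unfolding \<xi>_def by (rule A_op_H_plus[OF k2\<psi>])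
  have orth: "ip \<eta> h = 0" if "h \<in> H_plus Y s" for h
    unfolding \<eta>_def \<xi>_def by (rule A_op_orthogonal[OF k2\<psi> that])
  have \<eta>L2: "\<eta> \<in> L2_bd Y s" unfolding \<eta>_def by (intro V_intros k2\<psi> H_plus_L2 \<xi>)
  have "E 2 \<eta> = E 2 (mult_op k2 \<psi>) - E 2 \<xi>" by (simp add: \<eta>_def E_def mult_op_diff)
  then have E\<eta>: "E 2 \<eta> \<in> H_plus Y s"
    using subspace_diff[OF subspace_H_plus E_mult[OF holomorphic_multiplier_row[OF k2 row2] \<psi>] E_H[OF \<xi>]]
    by simp
  \<comment> \<open>\<open>E 2\<close> is a self-adjoint idempotent, so the squared length of
    \<open>E 2 \<eta>\<close> is the product of \<open>\<eta>\<close> with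
    \<open>E 2 \<eta>\<close>, an element of \<open>H_plus\<close>.\<close>
  have "E 2 (E 2 \<eta>) = E 2 \<eta>" by (simp add: E_def mult_op_def coord_proj_idem)
  then have null: "ip (E 2 \<eta>) (E 2 \<eta>) = 0" using orth[OF E\<eta>] by (simp add: E_selfadjoint)
  have orth': "ip (mult_op k1' \<eta>) h = 0" if h: "h \<in> H_plus Y s" for h
  proof -
    have L2h: "mult_op k1 h \<in> L2_bd Y s" by (intro L2 H_plus_L2 h)
    have "mult_op k1 h = E 1 (mult_op k1 h) + E 2 (mult_op k1 h)"
      by (simp add: E_def mult_op_def fun_eq_iff coord_proj_sum)
    then have "ip \<eta> (mult_op k1 h) = ip \<eta> (E 1 (mult_op k1 h)) + ip \<eta> (E 2 (mult_op k1 h))"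
      using ip_add_right[OF E_L2[OF L2h] E_L2[OF L2h] \<eta>L2] by metis
    also have "ip \<eta> (E 1 (mult_op k1 h)) = 0"
      by (intro orth E_mult holomorphic_multiplier_row k1 row1 h)
    also have "ip \<eta> (E 2 (mult_op k1 h)) = ip (E 2 \<eta>) (mult_op k1 h)" by (simp add: E_selfadjoint)
    \<comment> \<open>The second row of \<open>k1\<close> need not map into \<open>H_plus\<close>;
      this term vanishes because null sections are orthogonal to all square integrable ones.\<close>
    also have "\<dots> = 0" by (rule ip_eq_0_if_null[OF E_L2[OF \<eta>L2] L2h null])
    finally show ?thesis unfolding k1'_def ip_mult_op_adjoint by simp
  qed
  define \<zeta> where "\<zeta> = A_op Y s k1' \<xi>"
  have k1\<xi>: "mult_op k1' \<xi> \<in> L2_bd Y s" by (intro L2 H_plus_L2 \<xi>)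
  have \<zeta>: "\<zeta> \<in> H_plus Y s" unfolding \<zeta>_def by (rule A_op_H_plus[OF k1\<xi>])
  have eq: "mult_op (\<lambda>p. k1' p ** k2 p) \<psi> = mult_op k1' (mult_op k2 \<psi>)"
    by (simp add: mult_op_def matrix_vector_mul_assoc)
  have "ae_eq Y (A_op Y s (\<lambda>p. k1' p ** k2 p) \<psi>) \<zeta>"
  proof (rule A_op_unique[OF _ \<zeta>])
    show "mult_op (\<lambda>p. k1' p ** k2 p) \<psi> \<in> L2_bd Y s" unfolding eq by (intro L2 k2\<psi>)
    fix h assume h: "h \<in> H_plus Y s"
    \<comment> \<open>The residual of the candidate \<open>\<zeta>\<close> splits into
      \<open>k1'\<close> applied to \<open>\<eta>\<close> and the residual of projecting
      \<open>k1'\<close> applied to \<open>\<xi>\<close>; both are orthogonal to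
      \<open>H_plus\<close>.\<close>
    have "mult_op k1' (mult_op k2 \<psi>) - \<zeta> = mult_op k1' \<eta> + (mult_op k1' \<xi> - \<zeta>)"
      by (simp add: \<eta>_def mult_op_diff)
    moreover have "ip (mult_op k1' \<eta> + (mult_op k1' \<xi> - \<zeta>)) h =
        ip (mult_op k1' \<eta>) h + ip (mult_op k1' \<xi> - \<zeta>) h"
      by (intro ip_add_left V_intros L2 \<eta>L2 k1\<xi> H_plus_L2 \<zeta> h)
    moreover have "ip (mult_op k1' \<xi> - \<zeta>) h = 0"
      unfolding \<zeta>_def by (rule A_op_orthogonal[OF k1\<xi> h])
    ultimately show "ip (mult_op (\<lambda>p. k1' p ** k2 p) \<psi> - \<zeta>) h = 0"
      using orth'[OF h] by (simp only: eq add_0_left)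
  qed
  then show ?thesis by (simp add: k1'_def \<zeta>_def \<xi>_def)
qed

end

theorem theorem1p6:
  fixes Y :: "('a, 'i) surface"
    and s :: "'i \<Rightarrow> 'i \<Rightarrow> 'a \<Rightarrow> complex"
    and k1 k2 :: "'a \<Rightarrow> complex ^ 2 ^ 2"
    and a b c d :: "'a \<Rightarrow> complex"
  assumes "compact_connected_bordered_riemann_surface Y"
    and "bd Y \<noteq> {}"
    and "spin_structure Y s"
    and "dbar_invertible (double Y) (double_spin s)"
    and "measurable_multiloop Y k1"
    and "measurable_multiloop Y k2"
    and "\<forall>p\<in>bd Y. k1 p = vector [vector [a p, b p], vector [- cnj (b p), cnj (a p)]]"
    and "\<forall>p\<in>bd Y. k2 p = vector [vector [cnj (d p), - cnj (c p)], vector [c p, d p]]"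
    and "holomorphic_boundary_value Y a"
    and "holomorphic_boundary_value Y b"
    and "holomorphic_boundary_value Y c"
    and "holomorphic_boundary_value Y d"
  shows "\<forall>\<psi>\<in>H_plus Y s.
    ae_eq Y (A_op Y s (\<lambda>p. hermitian_adjoint (k1 p) ** k2 p) \<psi>)
      (A_op Y s (\<lambda>p. hermitian_adjoint (k1 p)) (A_op Y s k2 \<psi>))"
proof -
  interpret bordered_spin_surface Y s
    using assms(1,3) by unfold_locales
  \<comment> \<open>The matrices are prescribed on the boundary only, which is all that a boundary
    value sees.\<close>
  have "holomorphic_boundary_value Y (\<lambda>p. k1 p $ 1 $ 1)"
    "holomorphic_boundary_value Y (\<lambda>p. k1 p $ 1 $ 2)"
    by (rule holomorphic_boundary_value_cong[OF assms(9)], simp add: assms(7))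
      (rule holomorphic_boundary_value_cong[OF assms(10)], simp add: assms(7))
  then have "holomorphic_boundary_value Y (\<lambda>p. k1 p $ 1 $ l)" for l :: 2
    using exhaust_2[of l] by auto
  moreover have "holomorphic_boundary_value Y (\<lambda>p. k2 p $ 2 $ 1)"
    "holomorphic_boundary_value Y (\<lambda>p. k2 p $ 2 $ 2)"
    by (rule holomorphic_boundary_value_cong[OF assms(11)], simp add: assms(8))
      (rule holomorphic_boundary_value_cong[OF assms(12)], simp add: assms(8))
  then have "holomorphic_boundary_value Y (\<lambda>p. k2 p $ 2 $ l)" for l :: 2
    using exhaust_2[of l] by auto
  ultimately show ?thesis
    using A_op_adjoint_mult[OF assms(5,6)] by blast
qed

end
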